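(* Let $S=\mathbb{C}[x,y,z]$ and let $f\in S$ be a homogeneous polynomial of degree $d$ such that the projective plane curve $V(f): f=0$ in $\mathbb{P}^2$ has only isolated singularities. Assume that the saturated Jacobian ideal $\widehat{J}_f$ is a complete intersection ideal. Then the Hilbert-Poincaré series $HP(N(f))(t)$ of $N(f)=\widehat{J}_f/J_f$ is a log-concave polynomial with no internal zeros. In particular, $HP(N(f))(t)$ is a unimodal polynomial.
   Context: $S=\mathbb{C}[x,y,z]$ carries the standard grading. The Jacobian ideal $J_f\subset S$ is the ideal generated by the partial derivatives $f_x,f_y,f_z$ of $f$. The Milnor (Jacobian) algebra is $M(f)=S/J_f$. With $\mathbf{m}=(x,y,z)$, $\widehat{J}_f$ denotes the saturation of $J_f$ with respect to $\mathbf{m}$, i.e. $\widehat{J}_f=\{h\in S: \mathbf{m}^r h\subset J_f \text{ for some } r\ge 0\}$, and $N(f)=H^0_{\mathbf{m}}(M(f))=\widehat{J}_f/J_f$, a graded $S$-module. For a graded $S$-module $M$ of finite type, $HP(M)(t)=\sum_{k\ge 0}\dim_{\mathbb{C}} M_k\, t^k$. When $V(f)$ has only isolated singularities, $HP(N(f))(t)$ is a polynomial. Saying that $\widehat{J}_f$ is a complete intersection ideal (here for $n=2$) means that it is generated by $2$ homogeneous polynomials forming a regular sequence, of degrees $(d_1,d_2)$ (the multidegree). A sequence $a_0,\dots,a_m$ of real numbers is log-concave if $a_k^2\ge a_{k-1}a_{k+1}$ for $k=1,\dots,m-1$. It is unimodal if there is an integer $i$ between $0$ and $m$ with $a_0\le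 a_1\le\dots\le a_{i-1}\le a_i\ge a_{i+1}\ge\dots\ge a_m$. It has no internal zeros if the indices of its nonzero elements form a set of consecutive integers. A polynomial $P(t)=\sum_{j=0}^m a_jt^j\in\mathbb{R}[t]$ is log-concave (resp. unimodal, resp. has no internal zeros) if its sequence of coefficients $a_0,\dots,a_m$ has this property. *)

theory Defs
  imports
    "HOL-Analysis.Analysis"
    "HOL-Library.Poly_Mapping"
    "HOL-Library.Numeral_Type"
    "HOL-Algebra.Ideal_Product"
    "HOL-Algebra.QuotRing"
    "HOL-Algebra.Embedded_Algebras"
    "HOL-Algebra.Algebraic_Closure_Type"
    "HOL-Computational_Algebra.Polynomial_FPS"
begin

section \<open>The graded ring of complex polynomials in three variables\<close>

text \<open>
  Monomials are exponent vectors indexed by the three-element type \<^typ>\<open>3\<close>; a polynomial is a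
  finitely supported map from monomials to \<^typ>\<open>complex\<close>, with the convolution product.
\<close>

type_synonym mono3 = "3 \<Rightarrow>\<^sub>0 nat"
type_synonym poly3 = "mono3 \<Rightarrow>\<^sub>0 complex"

definition pvar :: "3 \<Rightarrow> poly3" where
  "pvar i = Poly_Mapping.single (Poly_Mapping.single i 1) 1"

definition pconst :: "complex \<Rightarrow> poly3" where
  "pconst c = Poly_Mapping.single 0 c"

definition mono_degree :: "mono3 \<Rightarrow> nat" where
  "mono_degree m = (\<Sum>i\<in>UNIV. Poly_Mapping.lookup m i)"

text \<open>The zero polynomial is homogeneous of every degree.\<close>

definition homogeneous :: "nat \<Rightarrow> poly3 \<Rightarrow> bool" where
  "homogeneous k p \<longleftrightarrow> (\<forall>m\<in>Poly_Mapping.keys p. mono_degree m = k)"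

text \<open>
  The truncated subtraction on exponents is harmless: if the exponent of the variable is \<open>0\<close>,
  then so is the coefficient.
\<close>

definition partial_deriv :: "3 \<Rightarrow> poly3 \<Rightarrow> poly3" where
  "partial_deriv i p = (\<Sum>m\<in>Poly_Mapping.keys p.
     Poly_Mapping.single (m - Poly_Mapping.single i 1)
       (of_nat (Poly_Mapping.lookup m i) * Poly_Mapping.lookup p m))"

definition poly3_eval :: "poly3 \<Rightarrow> complex ^ 3 \<Rightarrow> complex" where
  "poly3_eval p a = (\<Sum>m\<in>Poly_Mapping.keys p.
     Poly_Mapping.lookup p m * (\<Prod>i\<in>UNIV. vec_nth a i ^ Poly_Mapping.lookup m i))"

abbreviation S3 :: "poly3 ring" where
  "S3 \<equiv> ring_of_type_algebra"


section \<open>The projective plane and singular points of a plane curve\<close>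

text \<open>A point of the projective plane is its set of homogeneous coordinate vectors.\<close>

definition proj_point :: "complex ^ 3 \<Rightarrow> (complex ^ 3) set" where
  "proj_point a = {c *s a | c. c \<noteq> 0}"

definition proj_plane :: "(complex ^ 3) set set" where
  "proj_plane = proj_point ` (UNIV - {0})"

text \<open>The quotient of the Euclidean topology on the nonzero vectors.\<close>

definition proj_open :: "(complex ^ 3) set set \<Rightarrow> bool" where
  "proj_open U \<longleftrightarrow> U \<subseteq> proj_plane \<and> open (\<Union>U)"

definition singular_points :: "poly3 \<Rightarrow> (complex ^ 3) set set" where
  "singular_points f = {P \<in> proj_plane.
     \<forall>a\<in>P. poly3_eval f a = 0 \<and> (\<forall>i. poly3_eval (partial_deriv i f) a = 0)}"

definition only_isolated_singularities :: "poly3 \<Rightarrow> bool" where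
  "only_isolated_singularities f \<longleftrightarrow>
     (\<forall>P\<in>singular_points f. \<exists>U. proj_open U \<and> U \<inter> singular_points f = {P})"


section \<open>The Jacobian ideal, the Milnor algebra and the module \<open>N(f)\<close>\<close>

definition jacobian_ideal :: "poly3 \<Rightarrow> poly3 set" where
  "jacobian_ideal f = Idl\<^bsub>S3\<^esub> (range (\<lambda>i. partial_deriv i f))"

definition milnor_algebra :: "poly3 \<Rightarrow> poly3 set ring" where
  "milnor_algebra f = S3 Quot jacobian_ideal f"

definition irrelevant_ideal :: "poly3 set" where
  "irrelevant_ideal = Idl\<^bsub>S3\<^esub> (range pvar)"

definition irrelevant_power :: "nat \<Rightarrow> poly3 set" where
  "irrelevant_power r = (ideal_prod S3 irrelevant_ideal ^^ r) (carrier S3)"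

definition saturation :: "poly3 set \<Rightarrow> poly3 set" where
  "saturation I = {h. \<exists>r. \<forall>g\<in>irrelevant_power r. g * h \<in> I}"

definition saturated_jacobian_ideal :: "poly3 \<Rightarrow> poly3 set" where
  "saturated_jacobian_ideal f = saturation (jacobian_ideal f)"

text \<open>
  The module \<open>N(f)\<close> sits inside the Milnor algebra as the set of classes of elements of the
  saturated ideal; its part of degree \<open>k\<close> consists of the classes of the elements that are
  homogeneous of degree \<open>k\<close>.
\<close>

definition N_component :: "poly3 \<Rightarrow> nat \<Rightarrow> poly3 set set" where
  "N_component f k = (\<lambda>h. jacobian_ideal f +>\<^bsub>S3\<^esub> h) `
     {h \<in> saturated_jacobian_ideal f. homogeneous k h}"

definition milnor_scalars :: "poly3 \<Rightarrow> poly3 set set" where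
  "milnor_scalars f = (\<lambda>c. jacobian_ideal f +>\<^bsub>S3\<^esub> pconst c) ` UNIV"

definition HP_N :: "poly3 \<Rightarrow> real fps" where
  "HP_N f = Abs_fps (\<lambda>k. real (ring.dim (milnor_algebra f) (milnor_scalars f) (N_component f k)))"


section \<open>Complete intersection ideals\<close>

definition regular_sequence :: "poly3 list \<Rightarrow> bool" where
  "regular_sequence gs \<longleftrightarrow>
     (\<forall>i<length gs. \<forall>h. gs ! i * h \<in> Idl\<^bsub>S3\<^esub> (set (take i gs)) \<longrightarrow> h \<in> Idl\<^bsub>S3\<^esub> (set (take i gs)))
     \<and> Idl\<^bsub>S3\<^esub> (set gs) \<noteq> carrier S3"

text \<open>Two generators, the case of the projective plane.\<close>

definition complete_intersection_ideal :: "poly3 set \<Rightarrow> bool" where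
  "complete_intersection_ideal I \<longleftrightarrow>
     (\<exists>g1 g2 d1 d2. homogeneous d1 g1 \<and> homogeneous d2 g2 \<and>
        regular_sequence [g1, g2] \<and> I = Idl\<^bsub>S3\<^esub> {g1, g2})"


section \<open>Log-concave and unimodal polynomials\<close>

text \<open>In each definition the sequence is \<open>a 0, \<dots>, a m\<close>; later values of \<open>a\<close> are ignored.\<close>

definition log_concave_seq :: "(nat \<Rightarrow> real) \<Rightarrow> nat \<Rightarrow> bool" where
  "log_concave_seq a m \<longleftrightarrow> (\<forall>k. 1 \<le> k \<and> k < m \<longrightarrow> (a k)\<^sup>2 \<ge> a (k - 1) * a (k + 1))"

definition unimodal_seq :: "(nat \<Rightarrow> real) \<Rightarrow> nat \<Rightarrow> bool" where
  "unimodal_seq a m \<longleftrightarrow> (\<exists>i\<le>m. (\<forall>j<i. a j \<le> a (j + 1)) \<and> (\<forall>j. i \<le> j \<and> j < m \<longrightarrow> a j \<ge> a (j + 1)))"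

definition no_internal_zeros_seq :: "(nat \<Rightarrow> real) \<Rightarrow> nat \<Rightarrow> bool" where
  "no_internal_zeros_seq a m \<longleftrightarrow> (\<exists>p q. {j. j \<le> m \<and> a j \<noteq> 0} = {p..<q})"

definition log_concave_poly :: "real poly \<Rightarrow> bool" where
  "log_concave_poly P \<longleftrightarrow> log_concave_seq (Polynomial.coeff P) (Polynomial.degree P)"

definition unimodal_poly :: "real poly \<Rightarrow> bool" where
  "unimodal_poly P \<longleftrightarrow> unimodal_seq (Polynomial.coeff P) (Polynomial.degree P)"

definition no_internal_zeros_poly :: "real poly \<Rightarrow> bool" where
  "no_internal_zeros_poly P \<longleftrightarrow> no_internal_zeros_seq (Polynomial.coeff P) (Polynomial.degree P)"

end

theory Submission
  imports Defs
begin

text \<open>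
  Put \<open>e = d - 1\<close>, let \<open>J\<close> be the Jacobian ideal and \<open>I = (g1, g2)\<close> its saturation, with generators of
  degrees \<open>a\<close> and \<open>b\<close>. Since the polynomial ring is factorial, \<open>J = (f1, f2, f3)\<close> with \<open>f1, f2, f3\<close>
  of degree \<open>e\<close> and \<open>f1, f2\<close> a regular sequence. Writing \<open>f1, f2\<close> in terms of \<open>g1, g2\<close> gives a
  two-by-two matrix with determinant \<open>D\<close>, and linkage yields \<open>(f1, f2) : D = I\<close> and
  \<open>(f1, f2) : f3 = (f1, f2) : I = (f1, f2, D)\<close>. Hence the Hilbert function of \<open>I / J\<close> depends only on
  \<open>a, b, e\<close>: it is that of
  \<open>(t^a + t^b - t^(a+b) - 3t^e + 3t^(2e) + t^(3e-a-b) - t^(3e-a) - t^(3e-b)) / (1 - t)^3\<close>.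
  It is symmetric under \<open>k \<mapsto> 3e - 3 - k\<close>; in degrees below \<open>e\<close> it is the Hilbert function of \<open>I\<close>, which
  is log-concave by inspection, and in the middle range its second difference is nonpositive, so there
  log-concavity follows from the inequality of arithmetic and geometric means.
\<close>

section \<open>The numerical function\<close>

text \<open>No free resolution is used: each ideal is built one generator at a time, and each step
  costs one short exact sequence, so only colon ideals must be known. Saturation supplies the
  decisive one. If \<open>h * f3\<close> lies in \<open>(f1, f2)\<close>, then \<open>h\<close>
  carries \<open>J\<close>, hence some power of the irrelevant ideal times each element of
  \<open>I\<close>, into \<open>(f1, f2)\<close>. That ideal is itself saturated, because
  \<open>x, y, z\<close> is a regular sequence and \<open>f1, f2\<close> a regular pair; so
  \<open>h\<close> carries \<open>I\<close> into it. Two partial derivatives need not form a regular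
  pair, so \<open>f2\<close> is a combination of two of them. A common factor of all three would
  divide \<open>g1\<close> and \<open>g2\<close> and is therefore a unit; as one nonzero partial
  derivative has only finitely many prime factors, some scalar in the combination avoids them all.
  The numerical part needs three facts from algebra: \<open>a\<close> and \<open>b\<close> are
  positive because \<open>I\<close> is proper, they are at most \<open>e\<close> because
  \<open>D\<close> is nonzero, and the values are nonnegative because they are dimensions.\<close>

definition hilb3 :: "int \<Rightarrow> real" where
  "hilb3 k = (if k \<ge> 0 then (of_int k + 1) * (of_int k + 2) / 2 else 0)"

text \<open>The quadratic vanishes at \<open>-1\<close> and \<open>-2\<close>, so it stays exact two
  steps below the truncation. This slack lets three neighbouring degrees share one closed
  form.\<close>

lemma hilb3_ge: "k \<ge> -2 \<Longrightarrow> hilb3 k = (of_int k + 1) * (of_int k + 2) / 2"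
proof -
  assume "k \<ge> -2"
  then have "k \<ge> 0 \<or> k = -1 \<or> k = -2" by auto
  then show ?thesis by (auto simp: hilb3_def)
qed

lemma hilb3_neg [simp]: "k < 0 \<Longrightarrow> hilb3 k = 0"
  by (simp add: hilb3_def)

text \<open>The quadratic is invariant under replacing \<open>k\<close> by \<open>- 3 - k\<close>,
  and at most one of the two truncated terms is nonzero.\<close>

lemma hilb3_reflect: "(of_int k + 1) * (of_int k + 2) / 2 = hilb3 k + hilb3 (- 3 - k)"
proof (cases "k \<ge> -2")
  case True
  then show ?thesis by (simp add: hilb3_ge)
next
  case False
  then show ?thesis by (simp add: hilb3_ge field_simps)
qed

lemma hilb3_second_diff: "hilb3 (k + 1) - 2 * hilb3 k + hilb3 (k - 1) = (if k \<ge> -1 then 1 else 0)"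
proof (cases "k \<ge> -1")
  case True
  then show ?thesis by (simp add: hilb3_ge field_simps)
qed auto

section \<open>Symmetry and concavity of the Hilbert function\<close>

definition hilbN :: "int \<Rightarrow> int \<Rightarrow> int \<Rightarrow> int \<Rightarrow> real" where
  "hilbN a b e k = hilb3 (k - a) + hilb3 (k - b) - hilb3 (k - a - b) - 3 * hilb3 (k - e)
     + 3 * hilb3 (k - 2 * e) + hilb3 (k - 3 * e + a + b) - hilb3 (k - 3 * e + a) - hilb3 (k - 3 * e + b)"

lemma hilbN_commute: "hilbN a b e k = hilbN b a e k"
  by (simp add: hilbN_def algebra_simps)

text \<open>In the numerator of the series the exponents \<open>c\<close> and \<open>3e - c\<close>
  carry opposite coefficients. Reflection turns each truncated term into a full quadratic minus the
  truncated term of complementary shift, so only the sum of the quadratics has to vanish.\<close>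

lemma hilbN_symmetric: "hilbN a b e (3 * e - 3 - k) = hilbN a b e k"
proof -
  define q :: "int \<Rightarrow> real" where
    "q c = (of_int k - 3 * of_int e + of_int c + 1) * (of_int k - 3 * of_int e + of_int c + 2) / 2" for c
  have r: "hilb3 i = q c - hilb3 j" if "i = 3 * e - 3 - k - c" "j = k - 3 * e + c" for c i j
  proof -
    have i: "i = - 3 - j" using that by simp
    show ?thesis using hilb3_reflect[of j] by (simp add: i that(2) q_def)
  qed
  \<comment> \<open>The numerator vanishes to third order at \<open>t = 1\<close>, so it annihilates
    every quadratic.\<close>
  have "q a + q b - q (a + b) - 3 * q e + 3 * q (2 * e) + q (3 * e - a - b) - q (3 * e - a) - q (3 * e - b) = 0"
    unfolding q_def by (simp add: algebra_simps add_divide_distrib diff_divide_distrib)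
  moreover have
    "hilb3 (3 * e - 3 - k - a) = q a - hilb3 (k - 3 * e + a)"
    "hilb3 (3 * e - 3 - k - b) = q b - hilb3 (k - 3 * e + b)"
    "hilb3 (3 * e - 3 - k - a - b) = q (a + b) - hilb3 (k - 3 * e + a + b)"
    "hilb3 (3 * e - 3 - k - e) = q e - hilb3 (k - 2 * e)"
    "hilb3 (3 * e - 3 - k - 2 * e) = q (2 * e) - hilb3 (k - e)"
    "hilb3 (3 * e - 3 - k - 3 * e + a + b) = q (3 * e - a - b) - hilb3 (k - a - b)"
    "hilb3 (3 * e - 3 - k - 3 * e + a) = q (3 * e - a) - hilb3 (k - a)"
    "hilb3 (3 * e - 3 - k - 3 * e + b) = q (3 * e - b) - hilb3 (k - b)"
    by (rule r; simp)+
  ultimately show ?thesis unfolding hilbN_def by simp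
qed

text \<open>Second differences of \<open>hilb3\<close> are 0 or 1. In this range the term in
  \<open>k - e\<close> contributes \<open>-3\<close>, enough against the three other terms that can
  be positive, while the term in \<open>k - 2 * e\<close> does not contribute yet.\<close>

lemma hilbN_concave:
  assumes "1 \<le> a" "a \<le> b" "b \<le> e" "e - 1 \<le> k" "k \<le> 2 * e - 2"
  shows "hilbN a b e (k - 1) + hilbN a b e (k + 1) \<le> 2 * hilbN a b e k"
proof -
  define D where "D j = hilb3 (j + 1) - 2 * hilb3 j + hilb3 (j - 1)" for j
  have D: "D j = (if j \<ge> -1 then 1 else 0)" for j
    unfolding D_def by (rule hilb3_second_diff)
  have D01: "0 \<le> D j" "D j \<le> 1" for j by (auto simp: D)
  have "hilbN a b e (k + 1) - 2 * hilbN a b e k + hilbN a b e (k - 1) =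
      D (k - a) + D (k - b) - D (k - a - b) - 3 * D (k - e) + 3 * D (k - 2 * e)
      + D (k - 3 * e + a + b) - D (k - 3 * e + a) - D (k - 3 * e + b)"
    unfolding hilbN_def D_def by (simp add: algebra_simps)
  moreover have "D (k - e) = 1" "D (k - 2 * e) = 0"
    using assms by (auto simp: D)
  ultimately show ?thesis
    using D01[of "k - a"] D01[of "k - b"] D01[of "k - a - b"] D01[of "k - 3 * e + a + b"]
      D01[of "k - 3 * e + a"] D01[of "k - 3 * e + b"] by linarith
qed

lemma hilbN_low:
  assumes "1 \<le> a" "a \<le> b" "b \<le> e" "k < e"
  shows "hilbN a b e k = hilb3 (k - a) + hilb3 (k - b) - hilb3 (k - a - b)"
  using assms unfolding hilbN_def by simp

section \<open>Log-concavity and support\<close>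

lemma log_concave_centred_quadratic:
  fixes W g :: real
  assumes "2 * W\<^sup>2 + 2 * g \<ge> 1"
  shows "((W - 1)\<^sup>2 - g) * ((W + 1)\<^sup>2 - g) \<le> (W\<^sup>2 - g)\<^sup>2"
proof -
  have "(W\<^sup>2 - g)\<^sup>2 - ((W - 1)\<^sup>2 - g) * ((W + 1)\<^sup>2 - g) = 2 * W\<^sup>2 + 2 * g - 1"
    by (simp add: power2_eq_square algebra_simps)
  then show ?thesis using assms by linarith
qed

text \<open>After completing the square the defect is \<open>c^2\<close> times
  \<open>2 W^2 + 2 g - 1\<close>, with \<open>W\<close> the distance from the centre. Agreement with
  the quadratic is asked at three points only, so that each branch of a piecewise quadratic can be
  handled alone.\<close>

lemma log_concave_quadratic_int:
  fixes u :: "int \<Rightarrow> real"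
  assumes u: "\<And>j. \<bar>j - k\<bar> \<le> 1 \<Longrightarrow> u j = c * ((of_int j + w)\<^sup>2 - g)" and g: "2 * (of_int k + w)\<^sup>2 + 2 * g \<ge> 1"
  shows "u (k - 1) * u (k + 1) \<le> (u k)\<^sup>2"
proof -
  define W where "W = of_int k + w"
  have "u (k - 1) = c * ((W - 1)\<^sup>2 - g)" "u (k + 1) = c * ((W + 1)\<^sup>2 - g)" "u k = c * (W\<^sup>2 - g)"
    using u[of "k - 1"] u[of "k + 1"] u[of k] by (simp_all add: W_def algebra_simps)
  moreover have "c\<^sup>2 * (((W - 1)\<^sup>2 - g) * ((W + 1)\<^sup>2 - g)) \<le> c\<^sup>2 * (W\<^sup>2 - g)\<^sup>2"
    by (intro mult_left_mono log_concave_centred_quadratic) (use g in \<open>auto simp: W_def\<close>)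
  ultimately show ?thesis by (simp add: power_mult_distrib power2_eq_square mult_ac)
qed

lemma square_ge_shifted:
  fixes x h :: real
  assumes "x \<ge> h + 1/2" "h \<ge> 0"
  shows "2 * x\<^sup>2 + 2 * (1/4 - h\<^sup>2) \<ge> 1"
proof -
  have "(h + 1/2)\<^sup>2 \<le> x\<^sup>2" by (rule power_mono) (use assms in auto)
  moreover have "(h + 1/2)\<^sup>2 = h\<^sup>2 + h + 1/4" by (simp add: power2_eq_square algebra_simps)
  ultimately show ?thesis using assms(2) by (simp add: algebra_simps)
qed

text \<open>The breakpoints \<open>a\<close>, \<open>b\<close>, \<open>a + b\<close> are compared
  with \<open>k + 1\<close> rather than \<open>k\<close>: by the slack in \<open>hilb3_ge\<close>,
  the window \<open>k - 1, k, k + 1\<close> then never straddles two branches.\<close>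

lemma hilb_ci_log_concave:
  assumes ab: "1 \<le> a" "a \<le> b"
  defines "i \<equiv> \<lambda>k. hilb3 (k - a) + hilb3 (k - b) - hilb3 (k - a - b)"
  shows "i (k - 1) * i (k + 1) \<le> (i k)\<^sup>2"
proof -
  consider "k + 1 < a" | "a \<le> k + 1" "k + 1 < b" | "b \<le> k + 1" "k + 1 < a + b" | "a + b \<le> k + 1"
    by linarith
  then show ?thesis
  proof cases
    case 1
    then show ?thesis using ab by (simp add: i_def)
  next
    case 2
    have "real_of_int a \<le> of_int k + 1" using 2 by linarith
    then have W: "(of_int k + (3/2 - of_int a)) \<ge> (1/2::real)" by linarith
    have "(1/2)\<^sup>2 \<le> (of_int k + (3/2 - of_int a) :: real)\<^sup>2"
      by (rule power_mono[OF W]) simp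
    then have g: "2 * (of_int k + (3/2 - of_int a))\<^sup>2 + 2 * (1/4) \<ge> (1::real)"
      by (simp add: power2_eq_square)
    have "i j = 1/2 * ((of_int j + (3/2 - of_int a))\<^sup>2 - 1/4)" if "\<bar>j - k\<bar> \<le> 1" for j
    proof -
      have "j - a \<ge> -2" "j - b < 0" "j - a - b < 0" using that 2 ab by linarith+
      then have "i j = (of_int (j - a) + 1) * (of_int (j - a) + 2) / 2" unfolding i_def by (simp add: hilb3_ge)
      then show ?thesis by (simp add: power2_eq_square algebra_simps add_divide_distrib diff_divide_distrib)
    qed
    from log_concave_quadratic_int[OF this g] show ?thesis .
  next
    case 3
    define h where "h = (of_int b - of_int a) / (2::real)"
    have h: "h \<ge> 0" using ab by (simp add: h_def)
    have "real_of_int b \<le> of_int k + 1" using 3 by linarith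
    then have W: "(of_int k + (3/2 - (of_int a + of_int b) / 2)) \<ge> h + (1/2::real)" by (simp add: h_def add_divide_distrib diff_divide_distrib)
    note g = square_ge_shifted[OF W h]
    have "i j = 1 * ((of_int j + (3/2 - (of_int a + of_int b) / 2))\<^sup>2 - (1/4 - h\<^sup>2))" if "\<bar>j - k\<bar> \<le> 1" for j
    proof -
      have "j - a \<ge> -2" "j - b \<ge> -2" "j - a - b < 0" using that 3 ab by linarith+
      then have "i j = (of_int (j - a) + 1) * (of_int (j - a) + 2) / 2 + (of_int (j - b) + 1) * (of_int (j - b) + 2) / 2"
        unfolding i_def by (simp add: hilb3_ge)
      then show ?thesis by (simp add: h_def power2_eq_square algebra_simps add_divide_distrib diff_divide_distrib)
    qed
    from log_concave_quadratic_int[OF this g] show ?thesis .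
  next
    case 4
    \<comment> \<open>In the last branch the terms linear in \<open>a\<close> and \<open>b\<close>
      cancel, which leaves the constant \<open>1/4 + 2ab\<close>; with \<open>ab\<close> at least 1
      the bound holds whatever the distance from the centre.\<close>
    have "real_of_int a * of_int b \<ge> 1 * 1" by (rule mult_mono) (use ab in auto)
    moreover have "2 * x\<^sup>2 + 2 * (1/4 + 2 * p) \<ge> 1" if "p \<ge> 1 * 1" for x p :: real
    proof -
      have "0 \<le> x\<^sup>2" by simp
      then have "1 \<le> 2 * x\<^sup>2 + 4 * p" using that by linarith
      then show ?thesis by (simp add: algebra_simps)
    qed
    ultimately have g: "2 * (of_int k + 3/2)\<^sup>2 + 2 * (1/4 + 2 * (of_int a * of_int b)) \<ge> (1::real)"
      by blast
    have "i j = 1/2 * ((of_int j + 3/2)\<^sup>2 - (1/4 + 2 * (of_int a * of_int b)))" if "\<bar>j - k\<bar> \<le> 1" for j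
    proof -
      have "j - a \<ge> -2" "j - b \<ge> -2" "j - a - b \<ge> -2" using that 4 ab by linarith+
      then have "i j = (of_int (j - a) + 1) * (of_int (j - a) + 2) / 2 + (of_int (j - b) + 1) * (of_int (j - b) + 2) / 2
          - (of_int (j - a - b) + 1) * (of_int (j - a - b) + 2) / 2"
        unfolding i_def by (simp only: hilb3_ge)
      then show ?thesis by (simp add: power2_eq_square algebra_simps add_divide_distrib diff_divide_distrib)
    qed
    from log_concave_quadratic_int[OF this g] show ?thesis .
  qed
qed

lemma hilbN_log_concave_aux:
  assumes ab: "1 \<le> a" "a \<le> b" "b \<le> e" and nonneg: "\<And>k. hilbN a b e k \<ge> 0"
  shows "hilbN a b e (k - 1) * hilbN a b e (k + 1) \<le> (hilbN a b e k)\<^sup>2"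
proof -
  have low: "hilbN a b e (k - 1) * hilbN a b e (k + 1) \<le> (hilbN a b e k)\<^sup>2" if "k + 1 < e" for k
    using hilb_ci_log_concave[OF ab(1,2), of k] hilbN_low[OF ab, of k] hilbN_low[OF ab, of "k - 1"]
      hilbN_low[OF ab, of "k + 1"] that by simp
  consider "k + 1 < e" | "e - 1 \<le> k" "k \<le> 2 * e - 2" | "2 * e - 2 < k" by linarith
  then show ?thesis
  proof cases
    case 1
    then show ?thesis by (rule low)
  next
    case 2
    let ?x = "hilbN a b e (k - 1)" and ?y = "hilbN a b e (k + 1)"
    have "(?x + ?y)\<^sup>2 \<le> (2 * hilbN a b e k)\<^sup>2"
      by (rule power_mono[OF hilbN_concave[OF ab 2]]) (simp add: nonneg)
    moreover have "4 * (?x * ?y) \<le> (?x + ?y)\<^sup>2"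
      using zero_le_power2[of "?x - ?y"] by (simp add: power2_eq_square algebra_simps)
    ultimately show ?thesis by (simp add: power_mult_distrib)
  next
    case 3
    \<comment> \<open>Reflection swaps the two neighbours of \<open>k\<close> and moves
      \<open>k\<close> below \<open>e - 1\<close>, into the range of \<open>low\<close>.\<close>
    have r: "3 * e - 3 - k - 1 = 3 * e - 3 - (k + 1)" "3 * e - 3 - k + 1 = 3 * e - 3 - (k - 1)" by auto
    show ?thesis
      using low[of "3 * e - 3 - k"] 3 unfolding r hilbN_symmetric by (simp add: mult.commute)
  qed
qed

text \<open>From degree \<open>a\<close> on, the multiples of the generator of degree
  \<open>a\<close> alone outnumber the Koszul relations.\<close>

lemma hilb_ci_pos:
  assumes "1 \<le> a" "a \<le> b" "a \<le> k"
  shows "hilb3 (k - a) + hilb3 (k - b) - hilb3 (k - a - b) > 0"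
proof -
  have s0: "hilb3 j \<ge> 0" for j by (simp add: hilb3_def)
  have "hilb3 (k - a - b) < hilb3 (k - a)"
  proof (cases "k - a - b \<ge> 0")
    case True
    have r: "real_of_int (k - a - b) < real_of_int (k - a)" "0 \<le> real_of_int (k - a - b)" using assms True by linarith+
    have "(of_int (k - a - b) + 1) * (of_int (k - a - b) + 2) < (of_int (k - a) + 1) * (of_int (k - a) + 2 :: real)"
      by (rule mult_strict_mono) (use r in linarith)+
    then show ?thesis using True assms unfolding hilb3_def by simp
  next
    case False
    then show ?thesis using assms by (simp add: hilb3_def)
  qed
  then show ?thesis using s0[of "k - b"] by linarith
qed

text \<open>The values are positive from \<open>a\<close> up to \<open>e - 1\<close>, concavity
  carries this through the middle range, and symmetry gives the rest. The first alternative is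
  \<open>a = e\<close>, where all terms cancel.\<close>

lemma hilbN_support:
  assumes ab: "1 \<le> a" "a \<le> b" "b \<le> e" and nonneg: "\<And>k. hilbN a b e k \<ge> 0"
  shows "(\<forall>k. hilbN a b e k = 0) \<or> (\<forall>k. hilbN a b e k \<noteq> 0 \<longleftrightarrow> a \<le> k \<and> k \<le> 3 * e - 3 - a)"
proof (cases "a = e")
  case True
  then have eqs: "a = e" "b = e" using ab by auto
  have "k - e - e = k - 2 * e" "k - 3 * e + e + e = k - e" "k - 3 * e + e = k - 2 * e" for k by auto
  then have "hilbN a b e k = 0" for k unfolding eqs hilbN_def by simp
  then show ?thesis by blast
next
  case False
  then have ae: "a < e" using ab by simp
  have zero: "hilbN a b e k = 0" if "k < a" for k
    using hilbN_low[OF ab, of k] that ae ab by simp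
  have low: "hilbN a b e k > 0" if "a \<le> k" "k < e" for k
    using hilbN_low[OF ab, of k] hilb_ci_pos[OF ab(1,2), of k] that by simp
  \<comment> \<open>As the right neighbour is nonnegative, concavity gives twice the value at least
    the left neighbour. The induction starts at \<open>e - 1\<close>, the last degree governed by
    \<open>hilbN_low\<close>.\<close>
  have mid: "hilbN a b e (e - 1 + int n) \<noteq> 0" if "e - 1 + int n \<le> 2 * e - 2" for n
    using that
  proof (induction n)
    case 0
    then show ?case using low[of "e - 1"] ae by simp
  next
    case (Suc n)
    have "hilbN a b e (e - 1 + int n) \<noteq> 0"
      by (rule Suc.IH) (use Suc.prems in linarith)
    moreover have "hilbN a b e (e + int n - 1) + hilbN a b e (e + int n + 1) \<le> 2 * hilbN a b e (e + int n)"
      by (rule hilbN_concave[OF ab]) (use Suc.prems in linarith)+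
    moreover have eqs: "e + int n - 1 = e - 1 + int n" "e - 1 + int (Suc n) = e + int n" by auto
    ultimately show ?case
      using nonneg[of "e + int n + 1"] nonneg[of "e - 1 + int n"] unfolding eqs by linarith
  qed
  have iff: "hilbN a b e k \<noteq> 0 \<longleftrightarrow> a \<le> k" if "k \<le> 2 * e - 2" for k
  proof (cases "k < e")
    case True
    then show ?thesis using zero[of k] low[of k] by (cases "a \<le> k") auto
  next
    case False
    then have "e - 1 + int (nat (k - e + 1)) = k" by simp
    then have "hilbN a b e k \<noteq> 0" using mid[of "nat (k - e + 1)"] that by simp
    then show ?thesis using False ae by simp
  qed
  have "hilbN a b e k \<noteq> 0 \<longleftrightarrow> a \<le> k \<and> k \<le> 3 * e - 3 - a" for k
  proof (cases "k \<le> 2 * e - 2")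
    case True
    moreover from this have "k \<le> 3 * e - 3 - a" using ae by linarith
    ultimately show ?thesis using iff[of k] by blast
  next
    case False
    then have "hilbN a b e k \<noteq> 0 \<longleftrightarrow> a \<le> 3 * e - 3 - k"
    proof -
      have "3 * e - 3 - k \<le> 2 * e - 2" using False ae ab by linarith
      from iff[OF this] show ?thesis unfolding hilbN_symmetric .
    qed
    moreover have "a \<le> k" using False ae ab by linarith
    moreover have "a \<le> 3 * e - 3 - k \<longleftrightarrow> k \<le> 3 * e - 3 - a" by linarith
    ultimately show ?thesis by blast
  qed
  then show ?thesis by blast
qed

section \<open>Unimodality from log-concavity\<close>

lemma unimodal_seq_if_log_concave:
  assumes nonneg: "\<And>k. a k \<ge> 0" and lc: "log_concave_seq a m" and niz: "no_internal_zeros_seq a m"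
  shows "unimodal_seq a m"
proof -
  \<comment> \<open>The peak is the first index followed by a strict drop; the alternative
    \<open>j = m\<close> covers sequences that never drop.\<close>
  define i where "i = (LEAST j. j = m \<or> a j > a (j + 1))"
  have i: "i = m \<or> a i > a (i + 1)" unfolding i_def by (rule LeastI[of _ m]) simp
  have im: "i \<le> m" unfolding i_def by (rule Least_le) simp
  have up: "a j \<le> a (j + 1)" if "j < i" for j
    using not_less_Least[of j "\<lambda>j. j = m \<or> a j > a (j + 1)"] that unfolding i_def by auto
  obtain p q where pq: "{j. j \<le> m \<and> a j \<noteq> 0} = {p..<q}"
    using niz unfolding no_internal_zeros_seq_def by blast
  have supp: "j \<le> m \<Longrightarrow> a j \<noteq> 0 \<longleftrightarrow> p \<le> j \<and> j < q" for j
    using pq by (auto simp: set_eq_iff)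
  \<comment> \<open>The bound by \<open>p\<close> records that the support has been entered, so a
    zero met later is final. At positive values log-concavity makes one descent force the
    next.\<close>
  have down: "a (i + n + 1) \<le> a (i + n) \<and> p \<le> i + n" if "i + n < m" for n
    using that
  proof (induction n)
    case 0
    then have "a i > a (i + 1)" using i by auto
    moreover from this have "a i \<noteq> 0" using nonneg[of "i + 1"] by auto
    ultimately show ?case using supp[of i] im by auto
  next
    case (Suc n)
    have IH: "a (i + n + 1) \<le> a (i + n)" "p \<le> i + n" using Suc by auto
    have "a (i + n + 2) \<le> a (i + n + 1)"
    proof (cases "a (i + n + 1) = 0")
      case True
      then have "a (i + n + 2) = 0" using supp[of "i + n + 1"] supp[of "i + n + 2"] IH Suc.prems by auto
      then show ?thesis using True by simp
    next
      case False
      then have pos: "a (i + n + 1) > 0" using nonneg[of "i + n + 1"] by linarith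
      have "a (i + n) * a (i + n + 2) \<le> (a (i + n + 1))\<^sup>2"
        using lc[unfolded log_concave_seq_def, rule_format, of "i + n + 1"] Suc.prems by simp
      moreover have "a (i + n + 1) * a (i + n + 2) \<le> a (i + n) * a (i + n + 2)"
        by (rule mult_right_mono) (use IH nonneg in auto)
      ultimately have "a (i + n + 1) * a (i + n + 2) \<le> a (i + n + 1) * a (i + n + 1)"
        by (simp add: power2_eq_square)
      then show ?thesis using pos by (rule mult_left_le_imp_le)
    qed
    then show ?case using IH by simp
  qed
  have "a (j + 1) \<le> a j" if "i \<le> j" "j < m" for j
    using down[of "j - i"] that by simp
  then have "\<forall>j. i \<le> j \<and> j < m \<longrightarrow> a j \<ge> a (j + 1)" by blast
  then show ?thesis unfolding unimodal_seq_def using im up by blast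
qed

lemma hilbN_polynomial:
  assumes ab: "1 \<le> a" "1 \<le> b" "a \<le> e" "b \<le> e" and nonneg: "\<And>k. hilbN a b e k \<ge> 0"
  shows "\<exists>P. Abs_fps (\<lambda>k. hilbN a b e (int k)) = fps_of_poly P \<and> log_concave_poly P \<and>
    no_internal_zeros_poly P \<and> unimodal_poly P"
proof -
  have main: "\<exists>P. Abs_fps (\<lambda>k. hilbN a b e (int k)) = fps_of_poly P \<and> log_concave_poly P \<and>
      no_internal_zeros_poly P \<and> unimodal_poly P"
    if ab: "1 \<le> a" "a \<le> b" "b \<le> e" and nonneg: "\<And>k. hilbN a b e k \<ge> 0" for a b
  proof -
    have supp: "(\<forall>k. hilbN a b e k = 0) \<or> (\<forall>k. hilbN a b e k \<noteq> 0 \<longleftrightarrow> a \<le> k \<and> k \<le> 3 * e - 3 - a)"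
      by (rule hilbN_support[OF ab nonneg])
    have ev: "\<forall>k>nat (3 * e - 3 - a). hilbN a b e (int k) = 0"
    proof (intro allI impI)
      fix k assume "k > nat (3 * e - 3 - a)"
      then have "\<not> int k \<le> 3 * e - 3 - a" by linarith
      then show "hilbN a b e (int k) = 0" using supp by blast
    qed
    define P where "P = Abs_poly (\<lambda>k. hilbN a b e (int k))"
    have cP: "Polynomial.coeff P k = hilbN a b e (int k)" for k
      unfolding P_def using ev by (subst coeff_Abs_poly) auto
    have lc: "log_concave_poly P"
      unfolding log_concave_poly_def log_concave_seq_def cP
    proof (intro allI impI)
      fix k :: nat
      assume "1 \<le> k \<and> k < Polynomial.degree P"
      then have "int (k - 1) = int k - 1" "int (k + 1) = int k + 1" by auto
      then show "hilbN a b e (int (k - 1)) * hilbN a b e (int (k + 1)) \<le> (hilbN a b e (int k))\<^sup>2"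
        using hilbN_log_concave_aux[OF ab nonneg, of "int k"] by (simp only:)
    qed
    have niz: "no_internal_zeros_poly P"
      using supp
    proof
      assume z: "\<forall>k. hilbN a b e k = 0"
      have "{j. j \<le> Polynomial.degree P \<and> Polynomial.coeff P j \<noteq> 0} = {0..<0::nat}"
        unfolding cP using z by auto
      then show ?thesis unfolding no_internal_zeros_poly_def no_internal_zeros_seq_def by blast
    next
      assume s: "\<forall>k. hilbN a b e k \<noteq> 0 \<longleftrightarrow> a \<le> k \<and> k \<le> 3 * e - 3 - a"
      have "{j. j \<le> Polynomial.degree P \<and> Polynomial.coeff P j \<noteq> 0} = {j. Polynomial.coeff P j \<noteq> 0}"
        using le_degree by blast
      \<comment> \<open>The interval is half-open, hence \<open>3 * e - 2 - a\<close>, one more than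
        the last nonzero degree.\<close>
      also have "\<dots> = {nat a..<nat (3 * e - 2 - a)}"
      proof -
        have "a \<le> int j \<and> int j \<le> 3 * e - 3 - a \<longleftrightarrow> j \<in> {nat a..<nat (3 * e - 2 - a)}" for j
          unfolding atLeastLessThan_iff by linarith
        then have "Polynomial.coeff P j \<noteq> 0 \<longleftrightarrow> j \<in> {nat a..<nat (3 * e - 2 - a)}" for j
          unfolding cP s[rule_format] by blast
        then show ?thesis by blast
      qed
      finally show ?thesis unfolding no_internal_zeros_poly_def no_internal_zeros_seq_def by blast
    qed
    have "unimodal_poly P"
      unfolding unimodal_poly_def
      by (rule unimodal_seq_if_log_concave)
        (use lc niz nonneg in \<open>auto simp: cP log_concave_poly_def no_internal_zeros_poly_def\<close>)
    moreover have "Abs_fps (\<lambda>k. hilbN a b e (int k)) = fps_of_poly P"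
      by (rule fps_ext) (simp add: cP)
    ultimately show ?thesis using lc niz by (intro exI[of _ P] conjI)
  qed
  show ?thesis
  proof (cases "a \<le> b")
    case True
    show ?thesis by (rule main[OF ab(1) True ab(4) nonneg])
  next
    case False
    have "\<exists>P. Abs_fps (\<lambda>k. hilbN b a e (int k)) = fps_of_poly P \<and> log_concave_poly P \<and>
      no_internal_zeros_poly P \<and> unimodal_poly P"
    proof (rule main)
      show "hilbN b a e k \<ge> 0" for k using nonneg by (subst hilbN_commute)
    qed (use ab False in simp_all)
    then show ?thesis by (subst hilbN_commute)
  qed
qed

section \<open>Linkage of regular pairs\<close>

definition adjoin :: "'a::comm_ring_1 set \<Rightarrow> 'a \<Rightarrow> 'a set" where
  "adjoin B g = {b + h * g | b h. b \<in> B}"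

definition colon :: "'a::comm_ring_1 set \<Rightarrow> 'a \<Rightarrow> 'a set" where
  "colon B g = {h. h * g \<in> B}"

text \<open>Properness of the ideal is not part of the notion: \<open>f\<close> may be a unit, and
  this degenerate case is split off where it matters.\<close>

definition regular_pair :: "'a::comm_ring_1 \<Rightarrow> 'a \<Rightarrow> bool" where
  "regular_pair f g \<longleftrightarrow> f \<noteq> 0 \<and> (\<forall>h. f dvd h * g \<longrightarrow> f dvd h)"

lemma mem_adjoin_zero: "x \<in> adjoin {0} g \<longleftrightarrow> (\<exists>h. x = h * g)"
  by (auto simp: adjoin_def)

lemma mem_adjoin_zero_dvd: "x \<in> adjoin {0} g \<longleftrightarrow> g dvd x"
  by (auto simp: mem_adjoin_zero dvd_def mult.commute)

lemma mem_adjoin2: "x \<in> adjoin (adjoin {0} f) g \<longleftrightarrow> (\<exists>a b. x = a * f + b * g)"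
  by (auto simp: adjoin_def)

lemma mem_adjoin3: "x \<in> adjoin (adjoin (adjoin {0} f) g) h \<longleftrightarrow> (\<exists>a b c. x = a * f + b * g + c * h)"
  by (auto simp: adjoin_def)

text \<open>The only syzygies of a regular pair are the Koszul ones. The linkage arguments are
  repeated use of this.\<close>

lemma regular_pairE:
  fixes f g :: "'a::idom"
  assumes "regular_pair f g" "a * f = b * g"
  obtains c where "b = c * f" "a = c * g"
proof -
  have "f dvd b * g" using assms(2) by (metis dvd_triv_right)
  then obtain c where c: "b = c * f" using assms(1) unfolding regular_pair_def by (metis dvdE mult.commute)
  then have "a * f = (c * g) * f" using assms(2) by (simp add: mult_ac)
  then have "a = c * g" using assms(1) by (simp add: regular_pair_def)
  with c show thesis by (rule that)
qed

text \<open>With \<open>D\<close> the determinant, Cramer's rule gives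
  \<open>D * g1 = v2 * f1 - v1 * f2\<close> and \<open>D * g2 = u1 * f2 - u2 * f1\<close>, hence one
  inclusion. For the other, a representation of \<open>h * D\<close> is multiplied by
  \<open>g1\<close> and by \<open>g2\<close> and compared with Cramer's rule, which yields syzygies
  of \<open>f1, f2\<close>.\<close>

lemma colon_linked_determinant:
  fixes g1 g2 u1 v1 u2 v2 :: "'a::idom"
  assumes f1: "f1 = u1 * g1 + v1 * g2" and f2: "f2 = u2 * g1 + v2 * g2" and reg: "regular_pair f1 f2"
  shows "colon (adjoin (adjoin {0} f1) f2) (u1 * v2 - u2 * v1) = adjoin (adjoin {0} g1) g2"
proof (intro Set.set_eqI iffI)
  fix h
  assume "h \<in> adjoin (adjoin {0} g1) g2"
  then obtain p q where h: "h = p * g1 + q * g2" by (auto simp: mem_adjoin2)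
  have "h * (u1 * v2 - u2 * v1) = (p * v2 - q * u2) * f1 + (q * u1 - p * v1) * f2"
    unfolding h f1 f2 by (simp add: algebra_simps)
  then show "h \<in> colon (adjoin (adjoin {0} f1) f2) (u1 * v2 - u2 * v1)"
    by (auto simp: mem_adjoin2 colon_def)
next
  fix h
  assume "h \<in> colon (adjoin (adjoin {0} f1) f2) (u1 * v2 - u2 * v1)"
  then obtain p q where h: "h * (u1 * v2 - u2 * v1) = p * f1 + q * f2" by (auto simp: mem_adjoin2 colon_def)
  have "(h * v2 - g1 * p) * f1 = (h * v1 + g1 * q) * f2"
  proof -
    have "(h * v2 - g1 * p) * f1 - (h * v1 + g1 * q) * f2 = g1 * (h * (u1 * v2 - u2 * v1) - (p * f1 + q * f2))"
      unfolding f1 f2 by (simp add: algebra_simps)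
    then show ?thesis using h by simp
  qed
  then obtain w where w: "h * v1 + g1 * q = w * f1" by (rule regular_pairE[OF reg])
  have "(h * u2 + g2 * p) * f1 = (h * u1 - g2 * q) * f2"
  proof -
    have "(h * u2 + g2 * p) * f1 - (h * u1 - g2 * q) * f2 = g2 * ((p * f1 + q * f2) - h * (u1 * v2 - u2 * v1))"
      unfolding f1 f2 by (simp add: algebra_simps)
    then show ?thesis using h by simp
  qed
  then obtain w' where w': "h * u1 - g2 * q = w' * f1" by (rule regular_pairE[OF reg])
  \<comment> \<open>The terms with \<open>g1 * g2 * q\<close> cancel, and both brackets are
    multiples of \<open>f1\<close>, so \<open>f1\<close> can be divided out.\<close>
  have "h * f1 = g1 * (h * u1 - g2 * q) + g2 * (h * v1 + g1 * q)"
    unfolding f1 by (simp add: algebra_simps)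
  also have "\<dots> = (w' * g1 + w * g2) * f1" unfolding w w' by (simp add: algebra_simps)
  finally have "h = w' * g1 + w * g2" using reg by (simp add: regular_pair_def)
  then show "h \<in> adjoin (adjoin {0} g1) g2" by (auto simp: mem_adjoin2)
qed

text \<open>Expanding \<open>h * f1\<close> shows that \<open>h\<close> equals
  \<open>u1 * a1 + v1 * a2\<close> modulo \<open>f2\<close>, so it suffices to determine
  \<open>a1\<close> and \<open>a2\<close>. Computing \<open>h * g1 * g2\<close> in two ways
  restricts them to a multiple of the row \<open>(v2, - u2)\<close> plus a Koszul part; the row
  contributes the determinant.\<close>

lemma linked_colon_subset:
  fixes g1 g2 u1 v1 u2 v2 :: "'a::idom"
  assumes f1: "f1 = u1 * g1 + v1 * g2" and f2: "f2 = u2 * g1 + v2 * g2"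
    and reg: "regular_pair f1 f2" and regg: "regular_pair g1 g2"
    and hg: "h * g1 \<in> adjoin (adjoin {0} f1) f2" "h * g2 \<in> adjoin (adjoin {0} f1) f2"
  shows "h \<in> adjoin (adjoin (adjoin {0} f1) f2) (u1 * v2 - u2 * v1)"
proof -
  obtain a1 b1 where 1: "h * g1 = a1 * f1 + b1 * f2" using hg(1) by (auto simp: mem_adjoin2)
  obtain a2 b2 where 2: "h * g2 = a2 * f1 + b2 * f2" using hg(2) by (auto simp: mem_adjoin2)
  have "(h - u1 * a1 - v1 * a2) * f1 = (u1 * b1 + v1 * b2) * f2"
  proof -
    have "h * f1 = u1 * (h * g1) + v1 * (h * g2)" unfolding f1 by (simp add: algebra_simps)
    then show ?thesis unfolding 1 2 by (simp add: algebra_simps)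
  qed
  then obtain w where w: "h - u1 * a1 - v1 * a2 = w * f2" by (rule regular_pairE[OF reg])
  have "(g2 * a1 - g1 * a2) * f1 = (g1 * b2 - g2 * b1) * f2"
  proof -
    have "g2 * (h * g1) = g1 * (h * g2)" by (simp add: algebra_simps)
    then show ?thesis unfolding 1 2 by (simp add: algebra_simps)
  qed
  then obtain s where s: "g2 * a1 - g1 * a2 = s * f2" by (rule regular_pairE[OF reg])
  \<comment> \<open>Substituting for \<open>f2\<close> turns the relation into a syzygy of
    \<open>g1, g2\<close>.\<close>
  have "(a2 + s * u2) * g1 = (a1 - s * v2) * g2"
    using s unfolding f2 by (simp add: algebra_simps)
  then obtain t where t: "a1 - s * v2 = t * g1" "a2 + s * u2 = t * g2" by (rule regular_pairE[OF regg])
  have a: "a1 = s * v2 + t * g1" "a2 = t * g2 - s * u2" using t by (simp_all add: algebra_simps)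
  have "h = w * f2 + u1 * a1 + v1 * a2" using w by (simp add: algebra_simps)
  also have "\<dots> = w * f2 + u1 * (s * v2 + t * g1) + v1 * (t * g2 - s * u2)" unfolding a by simp
  also have "\<dots> = t * f1 + w * f2 + s * (u1 * v2 - u2 * v1)"
    unfolding f1 by (simp add: algebra_simps)
  finally show ?thesis by (auto simp: mem_adjoin3)
qed

text \<open>Cancelling \<open>p\<close> from the two factorizations leaves a syzygy of
  \<open>x, y\<close>, which makes the cofactor of \<open>x * q\<close> a multiple of
  \<open>x\<close>.\<close>

lemma dvd_if_dvd_mult_regular_pair:
  fixes x y :: "'a::idom"
  assumes reg: "regular_pair x y" and "p dvd x * q" "p dvd y * q" "p \<noteq> 0"
  shows "p dvd q"
proof -
  obtain a b where ab: "x * q = p * a" "y * q = p * b" using assms by (auto simp: dvd_def)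
  have "(p * b) * x = (p * a) * y"
    unfolding ab[symmetric] by (simp add: mult_ac)
  then have "p * (b * x) = p * (a * y)" by (simp add: mult_ac)
  then have "b * x = a * y" using \<open>p \<noteq> 0\<close> by simp
  then obtain c where "a = c * x" by (rule regular_pairE[OF reg])
  then have "x * q = x * (p * c)" using ab by (simp add: mult_ac)
  then have "q = p * c" using reg by (simp add: regular_pair_def)
  then show ?thesis by simp
qed

text \<open>The quotient by a regular sequence of length two has positive depth when \<open>x, y, z\<close> is a regular
  sequence; the coefficient \<open>w\<close> below is a Koszul cycle, hence a boundary.\<close>

lemma mem_adjoin2_if_mult_mem:
  fixes x y z f1 f2 :: "'a::idom"
  assumes xy: "regular_pair x y" and z: "colon (adjoin (adjoin {0} x) y) z \<subseteq> adjoin (adjoin {0} x) y"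
    and reg: "regular_pair f1 f2"
    and q: "x * q \<in> adjoin (adjoin {0} f1) f2" "y * q \<in> adjoin (adjoin {0} f1) f2" "z * q \<in> adjoin (adjoin {0} f1) f2"
  shows "q \<in> adjoin (adjoin {0} f1) f2"
proof -
  obtain a1 b1 where 1: "x * q = a1 * f1 + b1 * f2" using q(1) by (auto simp: mem_adjoin2)
  obtain a2 b2 where 2: "y * q = a2 * f1 + b2 * f2" using q(2) by (auto simp: mem_adjoin2)
  obtain a3 b3 where 3: "z * q = a3 * f1 + b3 * f2" using q(3) by (auto simp: mem_adjoin2)
  have syz: "\<exists>w. x * b' - y * b = w * f1 \<and> y * a - x * a' = w * f2"
    if "x * q = a * f1 + b * f2" "y * q = a' * f1 + b' * f2" for x y a b a' b'
  proof -
    have "y * (x * q) = x * (y * q)" by (simp add: mult_ac)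
    then have "(y * a - x * a') * f1 = (x * b' - y * b) * f2" unfolding that by (simp add: algebra_simps)
    then show ?thesis by (metis regular_pairE[OF reg])
  qed
  obtain w where w: "x * b2 - y * b1 = w * f1" "y * a1 - x * a2 = w * f2" using syz[OF 1 2] by blast
  obtain w' where w': "z * a1 - x * a3 = w' * f2" using syz[OF 1 3] by blast
  obtain w'' where w'': "z * a2 - y * a3 = w'' * f2" using syz[OF 2 3] by blast
  \<comment> \<open>If \<open>f2 = 0\<close>, then \<open>f1\<close> divides \<open>1 * f2\<close>
    and regularity makes it a unit.\<close>
  have f2: "f2 \<noteq> 0 \<or> f1 dvd 1"
    using reg unfolding regular_pair_def by (metis dvd_0_right mult_zero_right)
  show ?thesis
  proof (cases "f1 dvd 1")
    case True
    then obtain c where "1 = f1 * c" by (auto simp: dvd_def)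
    then have "q = (q * c) * f1 + 0 * f2" by (simp add: mult_ac)
    then show ?thesis unfolding mem_adjoin2 by blast
  next
    case False
    then have f2: "f2 \<noteq> 0" using f2 by simp
    have "z * (y * a1 - x * a2) - y * (z * a1 - x * a3) + x * (z * a2 - y * a3) = 0"
      by (simp add: algebra_simps)
    then have "(z * w - y * w' + x * w'') * f2 = 0" unfolding w w' w'' by (simp add: algebra_simps)
    then have "z * w - y * w' + x * w'' = 0" using f2 by simp
    then have "w * z = (- w'') * x + w' * y" by (simp add: algebra_simps)
    then have "w \<in> colon (adjoin (adjoin {0} x) y) z"
      unfolding colon_def mem_Collect_eq mem_adjoin2 by blast
    then have "w \<in> adjoin (adjoin {0} x) y" using z by blast
    then obtain B A where "w = B * x + A * y" by (auto simp: mem_adjoin2)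
    then have wAB: "w = A * y + B * x" by simp
    \<comment> \<open>Adding multiples of the Koszul relation of \<open>f1, f2\<close> to the
      representations turns their discrepancies into exact syzygies of \<open>x, y\<close>; the
      quotients \<open>E\<close> and \<open>G\<close> are the coefficients of
      \<open>q\<close>.\<close>
    have "(a2 + B * f2) * x = (a1 - A * f2) * y"
      using w(2) unfolding wAB by (simp add: algebra_simps)
    then obtain E where E: "a1 - A * f2 = E * x" by (rule regular_pairE[OF xy])
    have "(b2 - B * f1) * x = (b1 + A * f1) * y"
      using w(1) unfolding wAB by (simp add: algebra_simps)
    then obtain G where G: "b1 + A * f1 = G * x" by (rule regular_pairE[OF xy])
    have a: "a1 = A * f2 + E * x" "b1 = G * x - A * f1" using E G by (simp_all add: algebra_simps)
    have "x * q = x * (E * f1 + G * f2)" unfolding 1 a by (simp add: algebra_simps)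
    then have "q = E * f1 + G * f2" using xy by (simp add: regular_pair_def)
    then show ?thesis by (auto simp: mem_adjoin2)
  qed
qed

section \<open>Dimension of a sum with an image\<close>

text \<open>Rank-nullity for \<open>T\<close> modulo \<open>V\<close>: a basis of the kernel
  \<open>{u \<in> U. T u \<in> V}\<close> is extended to \<open>U\<close>, and the images of the
  added vectors extend a basis of \<open>V\<close> to one of the sum.\<close>

lemma (in vector_space) dim_add_image:
  assumes V: "subspace V" "finite FV" "V \<subseteq> span FV" and U: "subspace U" "finite FU" "U \<subseteq> span FU"
    and add: "\<And>x y. T (x + y) = T x + T y" and scl: "\<And>c x. T (scale c x) = scale c (T x)"
  shows "dim {v + T u | v u. v \<in> V \<and> u \<in> U} + dim {u \<in> U. T u \<in> V} = dim V + dim U"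
proof -
  define K where "K = {u \<in> U. T u \<in> V}"
  have T0: "T 0 = 0" using scl[of 0 0] by simp
  have Tdiff: "T (x - y) = T x - T y" for x y using add[of "x - y" y] by (simp add: algebra_simps)
  have subK: "subspace K"
    using V(1) U(1) unfolding subspace_def K_def by (auto simp: add scl T0)
  obtain BV where BV: "BV \<subseteq> V" "independent BV" "V \<subseteq> span BV" "card BV = dim V" by (rule basis_exists)
  have finBV: "finite BV" using independent_span_bound[OF V(2) BV(2)] BV(1) V(3) by blast
  have spanBV: "span BV = V" using BV(1,3) V(1) by (meson antisym span_minimal)
  obtain BK where BK: "BK \<subseteq> K" "independent BK" "K \<subseteq> span BK" "card BK = dim K" by (rule basis_exists)
  have spanBK: "span BK = K" using BK(1,3) subK by (meson antisym span_minimal)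
  have "BK \<subseteq> U" using BK(1) K_def by blast
  then obtain BU where BU: "BK \<subseteq> BU" "BU \<subseteq> U" "independent BU" "U \<subseteq> span BU"
    using maximal_independent_subset_extend[of BK U] BK(2) by blast
  have finBU: "finite BU" using independent_span_bound[OF U(2) BU(3)] BU(2) U(3) by blast
  have spanBU: "span BU = U" using BU(2,4) U(1) by (meson antisym span_minimal)
  have dimU: "card BU = dim U" by (rule basis_card_eq_dim[OF BU(2,4,3)])
  \<comment> \<open>The kernel basis \<open>BK\<close> stays in the span without adding to the
    count, because \<open>T\<close> sends it into \<open>V\<close>.\<close>
  have step: "\<exists>D. finite D \<and> independent D \<and> card D = card BV + card C \<and>
      span D = {v + T w | v w. v \<in> V \<and> w \<in> span (BK \<union> C)}"
    if "finite C" "C \<subseteq> BU - BK" for C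
    using that
  proof (induction C rule: finite_induct)
    case empty
    have "{v + T w | v w. v \<in> V \<and> w \<in> span (BK \<union> {})} = V"
    proof (intro equalityI subsetI)
      fix x assume "x \<in> {v + T w | v w. v \<in> V \<and> w \<in> span (BK \<union> {})}"
      then obtain v w where "x = v + T w" "v \<in> V" "w \<in> K" using spanBK by auto
      then show "x \<in> V" using V(1) by (auto simp: K_def subspace_add)
    next
      fix x assume "x \<in> V"
      then have "x = x + T 0" "x \<in> V" "0 \<in> span (BK \<union> {})" by (simp_all add: T0 span_zero)
      then show "x \<in> {v + T w | v w. v \<in> V \<and> w \<in> span (BK \<union> {})}" by blast
    qed
    then show ?case using finBV BV(2) spanBV by (intro exI[of _ BV]) simp
  next
    case (insert c C)
    then obtain D where D: "finite D" "independent D" "card D = card BV + card C"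
      "span D = {v + T w | v w. v \<in> V \<and> w \<in> span (BK \<union> C)}" by auto
    have c: "c \<in> BU" "c \<notin> BK" "c \<notin> C" using insert by auto
    have cU: "c \<in> U" using c BU by auto
    have sub: "BK \<union> C \<subseteq> BU - {c}" using insert.prems c BU(1) by auto
    have Tc: "T c \<notin> span D"
    proof
      assume "T c \<in> span D"
      then obtain v w where vw: "T c = v + T w" "v \<in> V" "w \<in> span (BK \<union> C)" unfolding D(4) by auto
      have "w \<in> span BU" using vw(3) sub span_mono[of "BK \<union> C" BU] by blast
      then have "w \<in> U" using spanBU by simp
      then have "c - w \<in> K"
        unfolding K_def using vw cU U(1) by (simp add: subspace_diff Tdiff)
      then have "c - w \<in> span (BK \<union> C)" using spanBK span_mono[of BK "BK \<union> C"] by blast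
      then have "c - w + w \<in> span (BK \<union> C)" using vw(3) by (rule span_add)
      then have "c \<in> span (BU - {c})" using span_mono[OF sub] by auto
      then show False using BU(3) c(1) by (auto simp: dependent_def)
    qed
    have "T c \<notin> D" using Tc span_base by blast
    then have card: "card (insert (T c) D) = card BV + card (insert c C)"
      using D insert.hyps by simp
    have "span (insert (T c) D) = {v + T w | v w. v \<in> V \<and> w \<in> span (BK \<union> insert c C)}"
    proof (intro equalityI subsetI)
      fix x assume "x \<in> span (insert (T c) D)"
      then obtain k where "x - scale k (T c) \<in> span D" by (auto simp: span_breakdown_eq)
      then obtain v w where vw: "x - scale k (T c) = v + T w" "v \<in> V" "w \<in> span (BK \<union> C)" unfolding D(4) by auto
      have "x = v + T (w + scale k c)" using vw(1) by (simp add: add scl algebra_simps)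
      moreover have "w + scale k c \<in> span (insert c (BK \<union> C))"
        using vw(3) by (auto simp: span_breakdown_eq intro!: exI[of _ k])
      ultimately show "x \<in> {v + T w | v w. v \<in> V \<and> w \<in> span (BK \<union> insert c C)}"
        using vw(2) by auto
    next
      fix x assume "x \<in> {v + T w | v w. v \<in> V \<and> w \<in> span (BK \<union> insert c C)}"
      then obtain v w where vw: "x = v + T w" "v \<in> V" "w \<in> span (insert c (BK \<union> C))" by auto
      then obtain k where k: "w - scale k c \<in> span (BK \<union> C)" by (auto simp: span_breakdown_eq)
      have "x - scale k (T c) = v + T (w - scale k c)" using vw(1) by (simp add: Tdiff scl algebra_simps)
      then have "x - scale k (T c) \<in> span D" unfolding D(4) using vw(2) k by blast
      then show "x \<in> span (insert (T c) D)" by (auto simp: span_breakdown_eq)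
    qed
    moreover have "independent (insert (T c) D)" by (rule independent_insertI[OF Tc D(2)])
    ultimately show ?case using card D(1) by blast
  qed
  have "finite (BU - BK)" using finBU by simp
  then obtain D where D: "independent D" "card D = card BV + card (BU - BK)"
    "span D = {v + T w | v w. v \<in> V \<and> w \<in> span (BK \<union> (BU - BK))}"
    using step[of "BU - BK"] by blast
  have "BK \<union> (BU - BK) = BU" using BU(1) by blast
  then have "span D = {v + T u | v u. v \<in> V \<and> u \<in> U}" using D(3) spanBU by simp
  then have "dim {v + T u | v u. v \<in> V \<and> u \<in> U} = card D"
    using dim_span_eq_card_independent[OF D(1)] by simp
  moreover have "card (BU - BK) + card BK = card BU"
    using BU(1) finBU by (metis card_Diff_subset card_mono finite_subset le_add_diff_inverse2)
  ultimately show ?thesis using D(2) BV(4) BK(4) dimU by (simp add: K_def)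
qed

section \<open>Homogeneous components and graded ideals\<close>

lemma poly3_as_sum: "p = (\<Sum>m\<in>Poly_Mapping.keys p. Poly_Mapping.single m (Poly_Mapping.lookup p m))"
  by (rule poly_mapping_eqI) (simp add: lookup_sum lookup_single when_def in_keys_iff)

lemma lookup_mult_single_add:
  fixes p :: poly3
  shows "Poly_Mapping.lookup (p * Poly_Mapping.single a c) (m + a) = Poly_Mapping.lookup p m * c"
proof -
  have "p * Poly_Mapping.single a c = (\<Sum>n\<in>Poly_Mapping.keys p. Poly_Mapping.single (n + a) (Poly_Mapping.lookup p n * c))"
    by (subst poly3_as_sum[of p]) (simp add: sum_distrib_right mult_single)
  then show ?thesis
    by (simp add: lookup_sum lookup_single when_def in_keys_iff)
qed

lemma lookup_pconst_mult: "Poly_Mapping.lookup (pconst c * p) m = c * Poly_Mapping.lookup p m"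
  using lookup_mult_single_add[of p 0 c m] by (simp add: pconst_def mult.commute)

lemma mono_degree_add: "mono_degree (m + n) = mono_degree m + mono_degree n"
  by (simp add: mono_degree_def lookup_add sum.distrib)

lemma mono_degree_single: "mono_degree (Poly_Mapping.single i n) = n"
  by (simp add: mono_degree_def lookup_single when_def)

lemma mono_degree_eq_0_iff: "mono_degree m = 0 \<longleftrightarrow> m = 0"
  unfolding mono_degree_def by (auto intro: poly_mapping_eqI)

lemma finite_mono_degree: "finite {m. mono_degree m = n}"
proof (rule finite_imageD)
  let ?f = "\<lambda>m :: mono3. (\<lambda>i. Poly_Mapping.lookup m i)"
  have "?f ` {m. mono_degree m = n} \<subseteq> UNIV \<rightarrow>\<^sub>E {..n}"
  proof (intro subsetI)
    fix g assume "g \<in> ?f ` {m. mono_degree m = n}"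
    then obtain m where m: "g = Poly_Mapping.lookup m" "mono_degree m = n" by auto
    have "g i \<le> n" for i
      using member_le_sum[of i UNIV "Poly_Mapping.lookup m"] m by (simp add: mono_degree_def)
    then show "g \<in> UNIV \<rightarrow>\<^sub>E {..n}" by auto
  qed
  then show "finite (?f ` {m. mono_degree m = n})"
    by (rule finite_subset) (simp add: finite_PiE)
  show "inj_on ?f {m. mono_degree m = n}"
    by (rule inj_onI) (simp add: lookup_inject)
qed

text \<open>Degrees are integers, so that components of negative degree exist and vanish.\<close>

definition homog :: "int \<Rightarrow> poly3 set" where
  "homog k = {p. \<forall>m\<in>Poly_Mapping.keys p. int (mono_degree m) = k}"

lemma homogeneous_iff_homog: "homogeneous k p \<longleftrightarrow> p \<in> homog (int k)"
  by (auto simp: homogeneous_def homog_def)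

lemma homog_iff: "p \<in> homog k \<longleftrightarrow> (\<forall>m. int (mono_degree m) \<noteq> k \<longrightarrow> Poly_Mapping.lookup p m = 0)"
  by (auto simp: homog_def in_keys_iff)

lemma homog_zero [simp]: "0 \<in> homog k"
  by (simp add: homog_def)

lemma homog_neg: "k < 0 \<Longrightarrow> homog k = {0}"
  by (auto simp: homog_iff intro!: poly_mapping_eqI)

lemma homog_add: "p \<in> homog k \<Longrightarrow> q \<in> homog k \<Longrightarrow> p + q \<in> homog k"
  by (simp add: homog_iff lookup_add)

lemma homog_diff: "p \<in> homog k \<Longrightarrow> q \<in> homog k \<Longrightarrow> p - q \<in> homog k"
  by (simp add: homog_iff lookup_minus)

lemma homog_mult:
  assumes "p \<in> homog j" "q \<in> homog k"
  shows "p * q \<in> homog (j + k)"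
  using keys_mult[of p q] assms unfolding homog_def by (fastforce simp: mono_degree_add)

lemma homog_pconst: "pconst c \<in> homog 0"
  by (auto simp: homog_def pconst_def mono_degree_eq_0_iff split: if_splits)

lemma homog_0_eq_pconst:
  assumes "p \<in> homog 0"
  shows "p = pconst (Poly_Mapping.lookup p 0)"
  by (rule poly_mapping_eqI)
    (use assms in \<open>auto simp: homog_iff pconst_def lookup_single when_def mono_degree_eq_0_iff\<close>)

lemma homog_pconst_mult: "p \<in> homog k \<Longrightarrow> pconst c * p \<in> homog k"
  by (simp add: homog_iff lookup_pconst_mult)

lemma homog_pvar: "pvar i \<in> homog 1"
  by (auto simp: homog_def pvar_def mono_degree_single split: if_splits)

definition hpart :: "int \<Rightarrow> poly3 \<Rightarrow> poly3" where
  "hpart k p = (\<Sum>m\<in>{m \<in> Poly_Mapping.keys p. int (mono_degree m) = k}.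
     Poly_Mapping.single m (Poly_Mapping.lookup p m))"

lemma lookup_hpart: "Poly_Mapping.lookup (hpart k p) m =
    (if int (mono_degree m) = k then Poly_Mapping.lookup p m else 0)"
  by (simp add: hpart_def lookup_sum lookup_single when_def in_keys_iff)

lemma hpart_homog: "hpart k p \<in> homog k"
  by (simp add: homog_iff lookup_hpart)

lemma hpart_of_homog: "p \<in> homog j \<Longrightarrow> hpart k p = (if j = k then p else 0)"
  by (rule poly_mapping_eqI) (auto simp: lookup_hpart homog_iff)

lemma hpart_self: "p \<in> homog k \<Longrightarrow> hpart k p = p"
  by (simp add: hpart_of_homog)

lemma hpart_add: "hpart k (p + q) = hpart k p + hpart k q"
  by (rule poly_mapping_eqI) (simp add: lookup_hpart lookup_add)

lemma hpart_zero [simp]: "hpart k 0 = 0"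
  by (rule poly_mapping_eqI) (simp add: lookup_hpart)

lemma hpart_sum: "hpart k (\<Sum>i\<in>A. p i) = (\<Sum>i\<in>A. hpart k (p i))"
  by (induction A rule: infinite_finite_induct) (simp_all add: hpart_add)

lemma sum_hpart: "(\<Sum>k\<in>(\<lambda>m. int (mono_degree m)) ` Poly_Mapping.keys p. hpart k p) = p"
proof (rule poly_mapping_eqI)
  fix m
  show "Poly_Mapping.lookup (\<Sum>k\<in>(\<lambda>m. int (mono_degree m)) ` Poly_Mapping.keys p. hpart k p) m = Poly_Mapping.lookup p m"
    by (cases "m \<in> Poly_Mapping.keys p") (auto simp: lookup_sum lookup_hpart in_keys_iff)
qed

lemma hpart_mult:
  assumes g: "g \<in> homog j"
  shows "hpart k (h * g) = hpart (k - j) h * g"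
proof -
  define I where "I = (\<lambda>m. int (mono_degree m)) ` Poly_Mapping.keys h"
  have "finite I" by (simp add: I_def)
  have part: "hpart k (hpart i h * g) = (if i = k - j then hpart i h * g else 0)" for i
    using hpart_of_homog[OF homog_mult[OF hpart_homog[of i h] g], of k] by auto
  have "h * g = (\<Sum>i\<in>I. hpart i h * g)"
    unfolding sum_distrib_right[symmetric] I_def sum_hpart ..
  then have "hpart k (h * g) = (\<Sum>i\<in>I. if i = k - j then hpart i h * g else 0)"
    by (simp only: hpart_sum part)
  also have "\<dots> = (if k - j \<in> I then hpart (k - j) h * g else 0)"
    using \<open>finite I\<close> by simp
  also have "\<dots> = hpart (k - j) h * g"
  proof (cases "k - j \<in> I")
    case False
    then have "Poly_Mapping.lookup h m = 0" if "int (mono_degree m) = k - j" for m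
      using that unfolding I_def by (metis image_eqI in_keys_iff)
    then have "hpart (k - j) h = 0"
      by (intro poly_mapping_eqI) (simp add: lookup_hpart)
    then show ?thesis by simp
  qed simp
  finally show ?thesis .
qed

definition graded_ideal :: "poly3 set \<Rightarrow> bool" where
  "graded_ideal B \<longleftrightarrow> 0 \<in> B \<and> (\<forall>p\<in>B. \<forall>q\<in>B. p + q \<in> B) \<and> (\<forall>p\<in>B. \<forall>r. r * p \<in> B)
     \<and> (\<forall>p\<in>B. \<forall>k. hpart k p \<in> B)"

lemma graded_ideal_diff: "graded_ideal B \<Longrightarrow> p \<in> B \<Longrightarrow> q \<in> B \<Longrightarrow> p - q \<in> B"
  unfolding graded_ideal_def by (metis ab_group_add_class.ab_diff_conv_add_uminus mult_minus1)

lemma graded_ideal_zero: "graded_ideal {0}"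
  by (simp add: graded_ideal_def)

lemma graded_ideal_UNIV: "graded_ideal UNIV"
  by (simp add: graded_ideal_def)

lemma graded_ideal_adjoin:
  assumes B: "graded_ideal B" and g: "g \<in> homog j"
  shows "graded_ideal (adjoin B g)"
  unfolding graded_ideal_def
proof (intro conjI ballI allI)
  have "0 \<in> B" using B by (simp add: graded_ideal_def)
  then show "0 \<in> adjoin B g" unfolding adjoin_def by (intro CollectI exI[of _ 0]) simp
  fix p assume "p \<in> adjoin B g"
  then obtain b h where p: "p = b + h * g" "b \<in> B" by (auto simp: adjoin_def)
  {
    fix q assume "q \<in> adjoin B g"
    then obtain b' h' where q: "q = b' + h' * g" "b' \<in> B" by (auto simp: adjoin_def)
    have "p + q = (b + b') + (h + h') * g" using p q by (simp add: algebra_simps)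
    moreover have "b + b' \<in> B" using B p q by (simp add: graded_ideal_def)
    ultimately show "p + q \<in> adjoin B g" unfolding adjoin_def by blast
  }
  {
    fix r
    have "r * p = r * b + (r * h) * g" using p by (simp add: algebra_simps)
    moreover have "r * b \<in> B" using B p by (simp add: graded_ideal_def)
    ultimately show "r * p \<in> adjoin B g" unfolding adjoin_def by blast
  }
  {
    fix k
    have "hpart k p = hpart k b + hpart (k - j) h * g" using p hpart_mult[OF g] by (simp add: hpart_add)
    moreover have "hpart k b \<in> B" using B p by (simp add: graded_ideal_def)
    ultimately show "hpart k p \<in> adjoin B g" unfolding adjoin_def by blast
  }
qed

text \<open>Since \<open>g\<close> is homogeneous, the component of degree \<open>k\<close> of any
  representation is again a representation.\<close>

lemma adjoin_homog:
  assumes B: "graded_ideal B" and g: "g \<in> homog j"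
  shows "adjoin B g \<inter> homog k = {b + h * g | b h. b \<in> B \<inter> homog k \<and> h \<in> homog (k - j)}"
proof (intro equalityI subsetI)
  fix p assume p: "p \<in> adjoin B g \<inter> homog k"
  then obtain b h where bh: "p = b + h * g" "b \<in> B" by (auto simp: adjoin_def)
  have "p = hpart k p" using p by (simp add: hpart_self)
  also have "\<dots> = hpart k b + hpart (k - j) h * g" using bh hpart_mult[OF g] by (simp add: hpart_add)
  finally show "p \<in> {b + h * g | b h. b \<in> B \<inter> homog k \<and> h \<in> homog (k - j)}"
    using B bh(2) hpart_homog unfolding graded_ideal_def by blast
next
  fix p assume "p \<in> {b + h * g | b h. b \<in> B \<inter> homog k \<and> h \<in> homog (k - j)}"
  then obtain b h where bh: "p = b + h * g" "b \<in> B" "b \<in> homog k" "h \<in> homog (k - j)" by blast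
  have "h * g \<in> homog k" using homog_mult[OF bh(4) g] by simp
  then show "p \<in> adjoin B g \<inter> homog k" using bh by (auto simp: adjoin_def homog_add)
qed

section \<open>Dimensions of graded pieces\<close>

interpretation poly3: vector_space "\<lambda>c p. pconst c * p"
proof
  show "pconst a * (x + y) = pconst a * x + pconst a * y" for a x y by (simp add: algebra_simps)
  show "pconst (a + b) * x = pconst a * x + pconst b * x" for a b x
    by (simp add: pconst_def single_add algebra_simps)
  show "pconst a * (pconst b * x) = pconst (a * b) * x" for a b x
    by (simp add: pconst_def mult_single mult.assoc[symmetric])
  show "pconst 1 * x = x" for x by (simp add: pconst_def)
qed

lemma subspace_graded_ideal: "graded_ideal B \<Longrightarrow> poly3.subspace (B \<inter> homog k)"
  unfolding poly3.subspace_def graded_ideal_def by (auto intro: homog_add homog_pconst_mult)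

lemma homog_subset_span: "homog k \<subseteq> poly3.span ((\<lambda>m. Poly_Mapping.single m 1) ` {m. mono_degree m = nat k})"
proof
  fix p assume p: "p \<in> homog k"
  have "p = (\<Sum>m\<in>Poly_Mapping.keys p. pconst (Poly_Mapping.lookup p m) * Poly_Mapping.single m 1)"
    by (subst poly3_as_sum) (simp add: pconst_def mult_single)
  also have "\<dots> \<in> poly3.span ((\<lambda>m. Poly_Mapping.single m 1) ` {m. mono_degree m = nat k})"
    by (intro poly3.span_sum poly3.span_scale poly3.span_base) (use p in \<open>auto simp: homog_def\<close>)
  finally show "p \<in> poly3.span ((\<lambda>m. Poly_Mapping.single m 1) ` {m. mono_degree m = nat k})" .
qed

lemma homog_finite_span: "\<exists>F. finite F \<and> homog k \<subseteq> poly3.span F"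
  using homog_subset_span[of k] finite_mono_degree[of "nat k"] by blast

text \<open>Real-valued, so that alternating sums involve no truncated subtraction.\<close>

definition hdim :: "poly3 set \<Rightarrow> int \<Rightarrow> real" where
  "hdim B k = real (poly3.dim (B \<inter> homog k))"

lemma hdim_zero: "hdim {0} k = 0"
  using poly3.dim_unique[of "{}" "{0}" 0]
  by (simp add: hdim_def poly3.independent_empty insert_absorb)

lemma hdim_neg: "k < 0 \<Longrightarrow> 0 \<in> B \<Longrightarrow> hdim B k = 0"
  using hdim_zero[of k] by (simp add: hdim_def homog_neg insert_absorb)

text \<open>This is additivity along \<open>0 -> (S/(B : g))(-j) -> S/B -> S/(B + (g)) -> 0\<close>.
  The Hilbert functions of the polynomial ring and of all ideals involved come from repeated use of
  it.\<close>

lemma hdim_adjoin: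
  assumes B: "graded_ideal B" and g: "g \<in> homog j"
  shows "hdim (adjoin B g) k = hdim B k + hdim UNIV (k - j) - hdim (colon B g) (k - j)"
proof -
  obtain F where F: "finite F" "homog k \<subseteq> poly3.span F" using homog_finite_span by blast
  obtain F' where F': "finite F'" "homog (k - j) \<subseteq> poly3.span F'" using homog_finite_span by blast
  have "poly3.dim {v + u * g | v u. v \<in> B \<inter> homog k \<and> u \<in> homog (k - j)}
      + poly3.dim {u \<in> homog (k - j). u * g \<in> B \<inter> homog k} = poly3.dim (B \<inter> homog k) + poly3.dim (homog (k - j))"
  proof (rule poly3.dim_add_image[OF subspace_graded_ideal[OF B] F(1) _ _ F'])
    show "poly3.subspace (homog (k - j))"
      using subspace_graded_ideal[OF graded_ideal_UNIV, of "k - j"] by simp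
  qed (use F(2) in \<open>auto simp: algebra_simps\<close>)
  moreover have "{u \<in> homog (k - j). u * g \<in> B \<inter> homog k} = colon B g \<inter> homog (k - j)"
    using homog_mult[OF _ g, of _ "k - j"] by (auto simp: colon_def)
  ultimately show ?thesis unfolding hdim_def adjoin_homog[OF B g] by simp
qed

section \<open>The Hilbert function of the polynomial ring\<close>

text \<open>The ideal generated by the variables in \<open>A\<close>, described by supports so that
  membership can be tested term by term.\<close>

definition monomial_ideal :: "3 set \<Rightarrow> poly3 set" where
  "monomial_ideal A = {p. \<forall>m\<in>Poly_Mapping.keys p. \<exists>i\<in>A. Poly_Mapping.lookup m i \<noteq> 0}"

lemma monomial_ideal_empty: "monomial_ideal {} = {0}"
  by (auto simp: monomial_ideal_def)

lemma pvar_mem_monomial_ideal: "i \<in> A \<Longrightarrow> pvar i \<in> monomial_ideal A"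
  by (auto simp: monomial_ideal_def pvar_def split: if_splits intro!: bexI[of _ i])

lemma keys_mult_pvar: "Poly_Mapping.keys (p * pvar j) = (\<lambda>m. m + Poly_Mapping.single j 1) ` Poly_Mapping.keys p"
proof (rule equalityI)
  show "Poly_Mapping.keys (p * pvar j) \<subseteq> (\<lambda>m. m + Poly_Mapping.single j 1) ` Poly_Mapping.keys p"
    using keys_mult[of p "pvar j"] by (auto simp: pvar_def split: if_splits)
  show "(\<lambda>m. m + Poly_Mapping.single j 1) ` Poly_Mapping.keys p \<subseteq> Poly_Mapping.keys (p * pvar j)"
  proof (rule image_subsetI)
    fix m assume "m \<in> Poly_Mapping.keys p"
    then show "m + Poly_Mapping.single j 1 \<in> Poly_Mapping.keys (p * pvar j)"
      unfolding in_keys_iff pvar_def lookup_mult_single_add by simp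
  qed
qed

lemma graded_ideal_monomial_ideal: "graded_ideal (monomial_ideal A)"
  unfolding graded_ideal_def
proof (intro conjI ballI allI)
  show "0 \<in> monomial_ideal A" by (simp add: monomial_ideal_def)
  fix p assume p: "p \<in> monomial_ideal A"
  show "p + q \<in> monomial_ideal A" if "q \<in> monomial_ideal A" for q
    using p that keys_add[of p q] unfolding monomial_ideal_def by blast
  show "r * p \<in> monomial_ideal A" for r
    unfolding monomial_ideal_def
  proof (intro CollectI ballI)
    fix m assume "m \<in> Poly_Mapping.keys (r * p)"
    then obtain a b where ab: "m = a + b" "b \<in> Poly_Mapping.keys p" using keys_mult[of r p] by auto
    then obtain i where "i \<in> A" "Poly_Mapping.lookup b i \<noteq> 0" using p unfolding monomial_ideal_def by blast
    then show "\<exists>i\<in>A. Poly_Mapping.lookup m i \<noteq> 0" using ab(1) by (auto simp: lookup_add)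
  qed
  have "Poly_Mapping.keys (hpart k p) \<subseteq> Poly_Mapping.keys p" for k
    by (auto simp: in_keys_iff lookup_hpart split: if_splits)
  then show "hpart k p \<in> monomial_ideal A" for k
    using p unfolding monomial_ideal_def by blast
qed

text \<open>Multiplication by \<open>pvar j\<close> changes exponents only at \<open>j\<close>,
  outside \<open>A\<close>.\<close>

lemma colon_monomial_ideal_pvar:
  assumes "j \<notin> A"
  shows "colon (monomial_ideal A) (pvar j) = monomial_ideal A"
proof -
  have "Poly_Mapping.lookup (m + Poly_Mapping.single j 1) i = Poly_Mapping.lookup m i" if "i \<in> A" for m i
    using that assms by (auto simp: lookup_add lookup_single when_def)
  then have eq: "(\<exists>i\<in>A. Poly_Mapping.lookup (m + Poly_Mapping.single j 1) i \<noteq> 0) \<longleftrightarrow> (\<exists>i\<in>A. Poly_Mapping.lookup m i \<noteq> 0)" for m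
    by (metis (no_types, lifting))
  show ?thesis
    unfolding colon_def monomial_ideal_def keys_mult_pvar ball_simps mem_Collect_eq eq ..
qed

lemma adjoin_monomial_ideal_pvar: "adjoin (monomial_ideal A) (pvar j) = monomial_ideal (insert j A)"
proof (rule equalityI)
  have I: "graded_ideal (monomial_ideal (insert j A))" by (rule graded_ideal_monomial_ideal)
  have "monomial_ideal A \<subseteq> monomial_ideal (insert j A)" by (auto simp: monomial_ideal_def)
  moreover have "pvar j \<in> monomial_ideal (insert j A)" by (simp add: pvar_mem_monomial_ideal)
  ultimately show "adjoin (monomial_ideal A) (pvar j) \<subseteq> monomial_ideal (insert j A)"
    using I unfolding graded_ideal_def adjoin_def by blast
  show "monomial_ideal (insert j A) \<subseteq> adjoin (monomial_ideal A) (pvar j)"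
  proof
    fix p assume p: "p \<in> monomial_ideal (insert j A)"
    have adj: "graded_ideal (adjoin (monomial_ideal A) (pvar j))"
      by (rule graded_ideal_adjoin[OF graded_ideal_monomial_ideal homog_pvar])
    have term_mem: "Poly_Mapping.single m (Poly_Mapping.lookup p m) \<in> adjoin (monomial_ideal A) (pvar j)"
      if m: "m \<in> Poly_Mapping.keys p" for m
    proof (cases "\<exists>i\<in>A. Poly_Mapping.lookup m i \<noteq> 0")
      case True
      then have "Poly_Mapping.single m (Poly_Mapping.lookup p m) \<in> monomial_ideal A"
        by (auto simp: monomial_ideal_def split: if_splits)
      then show ?thesis unfolding adjoin_def
        by (intro CollectI exI[of _ "Poly_Mapping.single m (Poly_Mapping.lookup p m)"] exI[of _ 0]) simp
    next
      case False
      then have mj: "Poly_Mapping.lookup m j \<noteq> 0" using p m by (auto simp: monomial_ideal_def)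
      have "m - Poly_Mapping.single j 1 + Poly_Mapping.single j 1 = m"
        by (rule poly_mapping_eqI) (use mj in \<open>auto simp: lookup_add lookup_minus lookup_single when_def\<close>)
      then have "Poly_Mapping.single m (Poly_Mapping.lookup p m) =
          0 + Poly_Mapping.single (m - Poly_Mapping.single j 1) (Poly_Mapping.lookup p m) * pvar j"
        by (simp add: pvar_def mult_single)
      moreover have "0 \<in> monomial_ideal A" by (simp add: monomial_ideal_def)
      ultimately show ?thesis unfolding adjoin_def by blast
    qed
    have "(\<Sum>m\<in>M. Poly_Mapping.single m (Poly_Mapping.lookup p m)) \<in> adjoin (monomial_ideal A) (pvar j)"
      if "finite M" "M \<subseteq> Poly_Mapping.keys p" for M
      using that
    proof (induction M rule: finite_induct)
      case empty
      then show ?case using adj by (simp add: graded_ideal_def)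
    next
      case (insert m M)
      then show ?case using adj term_mem[of m] by (simp add: graded_ideal_def)
    qed
    from this[of "Poly_Mapping.keys p"] show "p \<in> adjoin (monomial_ideal A) (pvar j)"
      using poly3_as_sum[of p] by simp
  qed
qed

lemma regular_pair_pvar:
  assumes "i \<noteq> j"
  shows "regular_pair (pvar i) (pvar j)"
proof -
  have "adjoin {0} (pvar i) = monomial_ideal {i}"
    using adjoin_monomial_ideal_pvar[of "{}" i] by (simp add: monomial_ideal_empty)
  then have "pvar i dvd p \<longleftrightarrow> p \<in> monomial_ideal {i}" for p
    by (metis mem_adjoin_zero_dvd)
  moreover have "pvar i \<noteq> 0" by (simp add: pvar_def) (metis lookup_single_eq lookup_zero zero_neq_one)
  moreover have "h * pvar j \<in> monomial_ideal {i} \<longleftrightarrow> h \<in> monomial_ideal {i}" for h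
    using colon_monomial_ideal_pvar[of j "{i}"] assms unfolding colon_def by auto
  ultimately show ?thesis by (simp add: regular_pair_def)
qed

lemma adjoin_pvar2: "adjoin (adjoin {0} (pvar i)) (pvar j) = monomial_ideal {i, j}"
  using adjoin_monomial_ideal_pvar[of "{}" i] adjoin_monomial_ideal_pvar[of "{i}" j]
  by (simp add: monomial_ideal_empty insert_commute)

lemma homog_subset_monomial_ideal_UNIV: "k \<noteq> 0 \<Longrightarrow> homog k \<subseteq> monomial_ideal UNIV"
proof
  fix p assume k: "k \<noteq> 0" and p: "p \<in> homog k"
  have "\<exists>i. Poly_Mapping.lookup m i \<noteq> 0" if "m \<in> Poly_Mapping.keys p" for m
  proof -
    have "int (mono_degree m) = k" using p that by (simp add: homog_def)
    then have "mono_degree m \<noteq> 0" using k by linarith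
    then show ?thesis unfolding mono_degree_def by (rule sum.not_neutral_contains_not_neutral) blast
  qed
  then show "p \<in> monomial_ideal UNIV" by (simp add: monomial_ideal_def)
qed

lemma hdim_UNIV_0: "hdim UNIV 0 = 1"
proof -
  have "homog 0 \<subseteq> poly3.span {1}"
  proof
    fix p assume "p \<in> homog 0"
    then have "p = pconst (Poly_Mapping.lookup p 0) * 1" using homog_0_eq_pconst by simp
    then show "p \<in> poly3.span {1}" by (metis poly3.span_base poly3.span_scale singletonI)
  qed
  moreover have "{1} \<subseteq> homog 0" using homog_pconst[of 1] by (simp add: pconst_def)
  moreover have "poly3.independent {1}"
    by (intro poly3.independent_insertI) (simp_all add: poly3.independent_empty)
  ultimately have "poly3.dim (homog 0) = 1"
    by (intro poly3.dim_unique[of "{1}"]) simp_all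
  then show ?thesis by (simp add: hdim_def)
qed

text \<open>Adjoining the three variables to 0 in turn yields the irrelevant ideal, which is
  everything in degrees other than 0. The result says that the Hilbert series times
  \<open>(1 - t)^3\<close> has no coefficient in such a degree.\<close>

lemma hdim_UNIV_recurrence:
  assumes "k \<noteq> 0"
  shows "hdim UNIV k = 3 * hdim UNIV (k - 1) - 3 * hdim UNIV (k - 2) + hdim UNIV (k - 3)"
proof -
  have step: "hdim (monomial_ideal (insert j A)) k =
      hdim (monomial_ideal A) k + hdim UNIV (k - 1) - hdim (monomial_ideal A) (k - 1)" if "j \<notin> A" for j A k
    using hdim_adjoin[OF graded_ideal_monomial_ideal[of A] homog_pvar[of j], of k]
    by (simp add: adjoin_monomial_ideal_pvar colon_monomial_ideal_pvar[OF that])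
  have 0: "hdim (monomial_ideal {}) k = 0" for k
    by (simp add: monomial_ideal_empty hdim_zero)
  have 1: "hdim (monomial_ideal {1}) k = hdim UNIV (k - 1)" for k
    using step[of 1 "{}" k] by (simp add: 0)
  have 2: "hdim (monomial_ideal {2, 1}) k = 2 * hdim UNIV (k - 1) - hdim UNIV (k - 2)" for k
    using step[of 2 "{1}" k] by (simp add: 1)
  have 3: "hdim (monomial_ideal {3, 2, 1}) k = 3 * hdim UNIV (k - 1) - 3 * hdim UNIV (k - 2) + hdim UNIV (k - 3)"
    using step[of 3 "{2, 1}" k] by (simp add: 2)
  have "monomial_ideal UNIV \<inter> homog k = UNIV \<inter> homog k"
    using homog_subset_monomial_ideal_UNIV[OF assms] by blast
  moreover have "(UNIV :: 3 set) = {3, 2, 1}" by (auto simp: UNIV_3)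
  ultimately show ?thesis using 3 by (simp add: hdim_def)
qed

lemma hilb3_recurrence:
  assumes "k > 0"
  shows "hilb3 k = 3 * hilb3 (k - 1) - 3 * hilb3 (k - 2) + hilb3 (k - 3)"
  using assms by (simp add: hilb3_ge) (simp add: algebra_simps)

lemma hdim_UNIV: "hdim UNIV k = hilb3 k"
proof -
  \<comment> \<open>The recurrence reaches back three degrees, so the induction runs over a strict
    upper bound of \<open>k\<close>; negative degrees are included and give 0 on both sides.\<close>
  have "hdim UNIV k = hilb3 k" if "k < int n" for n k
    using that
  proof (induction n arbitrary: k)
    case 0
    then show ?case by (simp add: hdim_neg)
  next
    case (Suc n)
    consider "k < 0" | "k = 0" | "k > 0" by linarith
    then show ?case
    proof cases
      case 1
      then show ?thesis by (simp add: hdim_neg)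
    next
      case 2
      then show ?thesis by (simp add: hdim_UNIV_0 hilb3_def)
    next
      case 3
      then show ?thesis
        using hdim_UNIV_recurrence[of k] hilb3_recurrence[OF 3] Suc.IH[of "k - 1"] Suc.IH[of "k - 2"]
          Suc.IH[of "k - 3"] Suc.prems by simp
    qed
  qed
  from this[of k "nat (k + 1)"] show ?thesis by (cases "k \<ge> 0") (simp_all add: hdim_neg)
qed

section \<open>Factoriality and the existence of a regular pair\<close>

text \<open>Pigeonhole: if every combination shared a prime with \<open>f\<close>, two of them would
  share the same one, as \<open>f\<close> has finitely many. That prime divides
  \<open>(c i - c j) * B\<close> with a unit in front, hence \<open>B\<close>, hence
  \<open>A\<close>.\<close>

lemma exists_prime_avoiding_combination:
  fixes f A B :: "'a::factorial_ring_gcd" and c :: "nat \<Rightarrow> 'a"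
  assumes f: "f \<noteq> 0" and c: "\<And>i j. i \<noteq> j \<Longrightarrow> c i - c j dvd 1"
    and avoid: "\<And>p. p dvd f \<Longrightarrow> p dvd A \<Longrightarrow> p dvd B \<Longrightarrow> p dvd 1"
  shows "\<exists>i. coprime f (A + c i * B)"
proof (rule ccontr)
  assume "\<not> ?thesis"
  then have nc: "\<not> coprime f (A + c i * B)" for i by blast
  have "\<exists>p. p \<in> prime_factors f \<and> p dvd A + c i * B" for i
  proof -
    let ?g = "gcd f (A + c i * B)"
    have "?g \<noteq> 0" "\<not> is_unit ?g" using f nc[of i] by (auto simp: coprime_iff_gcd_eq_1 is_unit_gcd_iff)
    then obtain p where "p dvd ?g" "normalization_semidom_class.prime p" using prime_divisor_exists by blast
    then show ?thesis using f by (intro exI[of _ p]) (auto simp: prime_factors_dvd)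
  qed
  then obtain p where p: "\<And>i. p i \<in> prime_factors f" "\<And>i. p i dvd A + c i * B" by metis
  have "finite (range p)" using p(1) by (auto intro: finite_subset[of _ "prime_factors f"])
  then have "\<not> inj p" using finite_imageD infinite_UNIV_nat by blast
  then obtain i j where ij: "i \<noteq> j" "p i = p j" by (auto simp: inj_def)
  have "p i dvd (A + c i * B) - (A + c j * B)" using p(2)[of i] p(2)[of j] ij(2) by (intro dvd_diff) simp_all
  then have "p i dvd (c i - c j) * B" by (simp add: algebra_simps)
  then have B: "p i dvd B" using c[OF ij(1)] by (metis dvd_mult_cancel_left dvd_mult_unit_iff' mult.commute)
  then have "p i dvd c i * B" by simp
  then have "p i dvd A" using p(2)[of i] by (metis dvd_add_left_iff)
  moreover have "p i dvd f" "normalization_semidom_class.prime (p i)" using p(1)[of i] by (auto simp: prime_factors_dvd)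
  ultimately show False using avoid[of "p i"] B by (meson not_prime_unit)
qed

text \<open>The isomorphism onto iterated univariate polynomials, with index 1 as the innermost
  variable. Gcds and prime factorizations are taken on that side; divisibility is carried
  back.\<close>

definition iter_poly :: "poly3 \<Rightarrow> complex poly poly poly" where
  "iter_poly p = (\<Sum>m\<in>Poly_Mapping.keys p.
     Polynomial.monom (Polynomial.monom (Polynomial.monom (Poly_Mapping.lookup p m)
       (Poly_Mapping.lookup m 1)) (Poly_Mapping.lookup m 2)) (Poly_Mapping.lookup m 3))"

abbreviation mono_of :: "nat \<Rightarrow> nat \<Rightarrow> nat \<Rightarrow> mono3" where
  "mono_of i j k \<equiv> Poly_Mapping.single 1 i + Poly_Mapping.single 2 j + Poly_Mapping.single 3 k"

lemma coeff_iter_poly: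
  "Polynomial.coeff (Polynomial.coeff (Polynomial.coeff (iter_poly p) k) j) i = Poly_Mapping.lookup p (mono_of i j k)"
proof -
  have "Poly_Mapping.lookup m 1 = i \<and> Poly_Mapping.lookup m 2 = j \<and> Poly_Mapping.lookup m 3 = k \<longleftrightarrow> m = mono_of i j k" for m :: mono3
  proof
    assume "Poly_Mapping.lookup m 1 = i \<and> Poly_Mapping.lookup m 2 = j \<and> Poly_Mapping.lookup m 3 = k"
    then have "Poly_Mapping.lookup m n = Poly_Mapping.lookup (mono_of i j k) n" for n
      using exhaust_3[of n] by (auto simp: lookup_add lookup_single)
    then show "m = mono_of i j k" by (rule poly_mapping_eqI)
  qed (simp add: lookup_add lookup_single)
  then have "Polynomial.coeff (Polynomial.coeff (Polynomial.coeff (Polynomial.monom (Polynomial.monom (Polynomial.monom c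
      (Poly_Mapping.lookup m 1)) (Poly_Mapping.lookup m 2)) (Poly_Mapping.lookup m 3)) k) j) i = (if m = mono_of i j k then c else 0)" for m :: mono3 and c :: complex
    by (auto simp: lookup_add lookup_single)
  then show ?thesis
    by (simp add: iter_poly_def coeff_sum in_keys_iff)
qed

lemma mono_of_lookup: "mono_of (Poly_Mapping.lookup m 1) (Poly_Mapping.lookup m 2) (Poly_Mapping.lookup m 3) = m"
proof (rule poly_mapping_eqI)
  fix n
  show "Poly_Mapping.lookup (mono_of (Poly_Mapping.lookup m 1) (Poly_Mapping.lookup m 2) (Poly_Mapping.lookup m 3)) n = Poly_Mapping.lookup m n"
    using exhaust_3[of n] by (auto simp: lookup_add lookup_single)
qed

lemma iter_poly_add: "iter_poly (p + q) = iter_poly p + iter_poly q"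
  by (intro poly_eqI) (simp add: coeff_iter_poly lookup_add)

lemma iter_poly_0: "iter_poly 0 = 0"
  by (simp add: iter_poly_def)

lemma iter_poly_sum: "iter_poly (\<Sum>i\<in>I. p i) = (\<Sum>i\<in>I. iter_poly (p i))"
  by (induction I rule: infinite_finite_induct) (simp_all add: iter_poly_0 iter_poly_add)

lemma iter_poly_single: "iter_poly (Poly_Mapping.single m c) =
    Polynomial.monom (Polynomial.monom (Polynomial.monom c
       (Poly_Mapping.lookup m 1)) (Poly_Mapping.lookup m 2)) (Poly_Mapping.lookup m 3)"
  by (simp add: iter_poly_def)

lemma iter_poly_mult: "iter_poly (p * q) = iter_poly p * iter_poly q"
proof -
  let ?t = "\<lambda>p m. Poly_Mapping.single m (Poly_Mapping.lookup p m)"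
  have "p * q = (\<Sum>m\<in>Poly_Mapping.keys p. \<Sum>n\<in>Poly_Mapping.keys q. ?t p m * ?t q n)"
    by (subst poly3_as_sum[of p], subst poly3_as_sum[of q]) (simp add: sum_product)
  then have "iter_poly (p * q) = (\<Sum>m\<in>Poly_Mapping.keys p. \<Sum>n\<in>Poly_Mapping.keys q. iter_poly (?t p m * ?t q n))"
    by (simp add: iter_poly_sum)
  also have "\<dots> = (\<Sum>m\<in>Poly_Mapping.keys p. \<Sum>n\<in>Poly_Mapping.keys q. iter_poly (?t p m) * iter_poly (?t q n))"
    by (simp add: mult_single iter_poly_single lookup_add mult_monom)
  also have "\<dots> = iter_poly p * iter_poly q"
    by (simp add: sum_product[symmetric] iter_poly_sum[symmetric] poly3_as_sum[symmetric])
  finally show ?thesis .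
qed

lemma iter_poly_1: "iter_poly 1 = 1"
  using iter_poly_single[of 0 1] by simp

lemma inj_iter_poly: "inj iter_poly"
proof (rule injI)
  fix p q assume eq: "iter_poly p = iter_poly q"
  show "p = q"
  proof (rule poly_mapping_eqI)
    fix m
    show "Poly_Mapping.lookup p m = Poly_Mapping.lookup q m"
      using coeff_iter_poly[of p] coeff_iter_poly[of q] eq mono_of_lookup[of m] by metis
  qed
qed

text \<open>The range is closed under sums and products and contains the constants and the three
  variables, so Horner's scheme reaches everything, one layer of variables at a time.\<close>

lemma surj_iter_poly: "surj iter_poly"
proof -
  let ?R = "range iter_poly"
  have add: "a + b \<in> ?R" if "a \<in> ?R" "b \<in> ?R" for a b
    using that by (auto simp: iter_poly_add[symmetric])
  have mult: "a * b \<in> ?R" if "a \<in> ?R" "b \<in> ?R" for a b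
    using that by (auto simp: iter_poly_mult[symmetric])
  have const: "[:[:[:c:]:]:] \<in> ?R" for c
    using iter_poly_single[of 0 c] by (metis lookup_zero monom_0 rangeI)
  have v1: "[:[:[:0, 1:]:]:] \<in> ?R"
    using rangeI[of iter_poly "Poly_Mapping.single (Poly_Mapping.single 1 1) 1"]
    by (simp add: iter_poly_single lookup_single monom_altdef one_pCons)
  have v2: "[:[:0, 1:]:] \<in> ?R"
    using rangeI[of iter_poly "Poly_Mapping.single (Poly_Mapping.single 2 1) 1"]
    by (simp add: iter_poly_single lookup_single monom_altdef one_pCons)
  have v3: "[:0, 1:] \<in> ?R"
    using rangeI[of iter_poly "Poly_Mapping.single (Poly_Mapping.single 3 1) 1"]
    by (simp add: iter_poly_single lookup_single monom_altdef one_pCons)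
  have 1: "[:[:a:]:] \<in> ?R" for a
  proof (induction a)
    case 0
    show ?case using const[of 0] by simp
  next
    case (pCons c a)
    have "[:[:pCons c a:]:] = [:[:[:c:]:]:] + [:[:[:0, 1:]:]:] * [:[:a:]:]" by simp
    then show ?case using add[OF const[of c] mult[OF v1 pCons.IH]] by (simp only:)
  qed
  have 2: "[:a:] \<in> ?R" for a
  proof (induction a)
    case 0
    show ?case using const[of 0] by simp
  next
    case (pCons c a)
    have "[:pCons c a:] = [:[:c:]:] + [:[:0, 1:]:] * [:a:]" by simp
    then show ?case using add[OF 1[of c] mult[OF v2 pCons.IH]] by (simp only:)
  qed
  have "a \<in> ?R" for a
  proof (induction a)
    case 0
    show ?case using const[of 0] by simp
  next
    case (pCons c a)
    have "pCons c a = [:c:] + [:0, 1:] * a" by simp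
    then show ?case using add[OF 2[of c] mult[OF v3 pCons.IH]] by (simp only:)
  qed
  then show ?thesis by blast
qed

lemma iter_poly_dvd_iff: "iter_poly p dvd iter_poly q \<longleftrightarrow> p dvd q"
proof
  assume "iter_poly p dvd iter_poly q"
  then obtain k where "iter_poly q = iter_poly p * k" by (auto simp: dvd_def)
  moreover obtain r where "k = iter_poly r" using surj_iter_poly by blast
  ultimately have "iter_poly q = iter_poly (p * r)" by (simp add: iter_poly_mult)
  then have "q = p * r" using inj_iter_poly by (simp add: inj_eq)
  then show "p dvd q" by simp
qed (auto simp: dvd_def iter_poly_mult)

text \<open>The natural numbers supply infinitely many scalars whose differences are units in
  characteristic 0. Coprimality then gives regularity, since a coprime factor may be dropped from a
  divisibility.\<close>

lemma exists_regular_pair: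
  fixes f A B :: poly3
  assumes f: "f \<noteq> 0" and avoid: "\<And>p. p dvd f \<Longrightarrow> p dvd A \<Longrightarrow> p dvd B \<Longrightarrow> p dvd 1"
  shows "\<exists>c. regular_pair f (A + pconst c * B)"
proof -
  have "\<exists>i. coprime (iter_poly f) (iter_poly A + iter_poly (pconst (of_nat i)) * iter_poly B)"
  proof (rule exists_prime_avoiding_combination)
    show "iter_poly f \<noteq> 0" using f inj_iter_poly iter_poly_0 by (metis injD)
  next
    fix i j :: nat
    assume "i \<noteq> j"
    then have "iter_poly (pconst (of_nat i)) = iter_poly (pconst (of_nat j)) + iter_poly (pconst (of_nat i - of_nat j))"
      unfolding iter_poly_add[symmetric] pconst_def single_add[symmetric] by simp
    moreover have "iter_poly (pconst (of_nat i - of_nat j)) * iter_poly (pconst (inverse (of_nat i - of_nat j))) = 1"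
      using \<open>i \<noteq> j\<close> by (simp add: iter_poly_mult[symmetric] pconst_def mult_single iter_poly_1)
    ultimately show "iter_poly (pconst (of_nat i)) - iter_poly (pconst (of_nat j)) dvd 1"
      by (metis add_diff_cancel_left' dvd_triv_left)
  next
    fix p assume "p dvd iter_poly f" "p dvd iter_poly A" "p dvd iter_poly B"
    moreover obtain r where "p = iter_poly r" using surj_iter_poly by blast
    ultimately show "p dvd 1" using avoid[of r] iter_poly_1 by (metis iter_poly_dvd_iff)
  qed
  then obtain c where c: "coprime (iter_poly f) (iter_poly (A + pconst c * B))"
    by (auto simp: iter_poly_add iter_poly_mult)
  have "f dvd h" if "f dvd h * (A + pconst c * B)" for h
  proof -
    have "iter_poly f dvd iter_poly h * iter_poly (A + pconst c * B)"
      using that by (simp only: iter_poly_mult[symmetric] iter_poly_dvd_iff)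
    then have "iter_poly f dvd iter_poly h" using c by (simp add: coprime_dvd_mult_left_iff)
    then show ?thesis by (simp only: iter_poly_dvd_iff)
  qed
  then show ?thesis using f unfolding regular_pair_def by blast
qed

section \<open>Translation to the ring-theoretic definitions\<close>

lemma S3_simps [simp]:
  "carrier S3 = UNIV" "x \<otimes>\<^bsub>S3\<^esub> y = x * y" "x \<oplus>\<^bsub>S3\<^esub> y = x + y" "\<zero>\<^bsub>S3\<^esub> = 0" "\<one>\<^bsub>S3\<^esub> = 1"
  by (simp_all add: ring_of_type_algebra_def)

lemma S3_cring: "cring S3" by (rule cring_from_type_algebra)

lemma S3_ring: "ring S3" by (rule ring_from_type_algebra)

lemma S3_a_inv: "\<ominus>\<^bsub>S3\<^esub> x = - x"
proof -
  interpret ring S3 by (rule S3_ring)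
  show ?thesis by (rule minus_equality) simp_all
qed

lemma ideal_S3_iff: "ideal I S3 \<longleftrightarrow> 0 \<in> I \<and> (\<forall>p\<in>I. \<forall>q\<in>I. p + q \<in> I) \<and> (\<forall>p\<in>I. \<forall>r. r * p \<in> I)"
proof
  assume "ideal I S3"
  then interpret ideal I S3 .
  show "0 \<in> I \<and> (\<forall>p\<in>I. \<forall>q\<in>I. p + q \<in> I) \<and> (\<forall>p\<in>I. \<forall>r. r * p \<in> I)"
    using additive_subgroup.zero_closed[OF additive_subgroup_axioms] additive_subgroup.a_closed[OF additive_subgroup_axioms] I_l_closed
    by auto
next
  assume I: "0 \<in> I \<and> (\<forall>p\<in>I. \<forall>q\<in>I. p + q \<in> I) \<and> (\<forall>p\<in>I. \<forall>r. r * p \<in> I)"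
  interpret ring S3 by (rule S3_ring)
  have "- a \<in> I" if "a \<in> I" for a
    using I that by (metis mult_minus1)
  then have "subgroup I (add_monoid S3)"
    using I by (intro add.subgroupI) (auto simp: a_inv_def[symmetric] S3_a_inv)
  then show "ideal I S3"
    using I by (intro idealI[OF S3_ring]) (auto simp: mult.commute)
qed

lemma ideal_if_graded_ideal: "graded_ideal B \<Longrightarrow> ideal B S3"
  by (auto simp: graded_ideal_def ideal_S3_iff)

lemma Idl_empty: "Idl\<^bsub>S3\<^esub> {} = {0}"
proof -
  interpret ring S3 by (rule S3_ring)
  have "Idl\<^bsub>S3\<^esub> {} \<subseteq> {0}"
    by (rule genideal_minimal) (auto simp: ideal_S3_iff)
  moreover have "ideal (Idl\<^bsub>S3\<^esub> {}) S3" by (rule genideal_ideal) simp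
  ultimately show ?thesis by (auto simp: ideal_S3_iff)
qed

text \<open>The second conclusion renews the assumption on \<open>B\<close>, so that generators can
  be inserted one after another.\<close>

lemma Idl_insert:
  assumes B: "Idl\<^bsub>S3\<^esub> G = B" "graded_ideal B" and g: "g \<in> homog j"
  shows "Idl\<^bsub>S3\<^esub> (insert g G) = adjoin B g" "graded_ideal (adjoin B g)"
proof -
  interpret ring S3 by (rule S3_ring)
  show gr: "graded_ideal (adjoin B g)" by (rule graded_ideal_adjoin[OF B(2) g])
  have G: "G \<subseteq> B" using genideal_self[of G] B(1) by simp
  have mem: "b + h * g \<in> adjoin B g" if "b \<in> B" for b h using that unfolding adjoin_def by blast
  have "B \<subseteq> adjoin B g" using mem[of _ 0] by auto
  moreover have "g \<in> adjoin B g" using mem[of 0 1] B(2) by (simp add: graded_ideal_def)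
  ultimately have "Idl\<^bsub>S3\<^esub> (insert g G) \<subseteq> adjoin B g"
    using G by (intro genideal_minimal ideal_if_graded_ideal[OF gr]) auto
  moreover have "ideal (Idl\<^bsub>S3\<^esub> (insert g G)) S3" by (rule genideal_ideal) simp
  moreover have "insert g G \<subseteq> Idl\<^bsub>S3\<^esub> (insert g G)" by (rule genideal_self) simp
  moreover have "B \<subseteq> Idl\<^bsub>S3\<^esub> (insert g G)"
    using subset_Idl_subset[of "insert g G" G] B(1) by auto
  ultimately show "Idl\<^bsub>S3\<^esub> (insert g G) = adjoin B g"
    unfolding ideal_S3_iff adjoin_def by blast
qed

lemma pvar_mult_mem_irrelevant_power:
  assumes "g \<in> irrelevant_power r"
  shows "pvar i * g \<in> irrelevant_power (Suc r)"
proof -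
  interpret ring S3 by (rule S3_ring)
  have "range pvar \<subseteq> irrelevant_ideal" unfolding irrelevant_ideal_def by (rule genideal_self) simp
  then have "pvar i \<otimes>\<^bsub>S3\<^esub> g \<in> ideal_prod S3 irrelevant_ideal (irrelevant_power r)"
    using assms by (intro ideal_prod.prod) auto
  then show ?thesis by (simp add: irrelevant_power_def)
qed

text \<open>One power of the irrelevant ideal is peeled off at a time. The set \<open>Q\<close> is
  left general in order to serve both for the multiples of one polynomial and for the ideal
  \<open>(f1, f2)\<close>.\<close>

lemma mem_if_irrelevant_power_mult_mem:
  assumes Q: "\<And>q. (\<And>i. pvar i * q \<in> Q) \<Longrightarrow> q \<in> Q" and h: "\<And>g. g \<in> irrelevant_power r \<Longrightarrow> g * h \<in> Q"
  shows "h \<in> Q"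
  using h
proof (induction r)
  case 0
  have "1 \<in> irrelevant_power 0" by (simp add: irrelevant_power_def)
  then show ?case using 0[of 1] by simp
next
  case (Suc r)
  show ?case
  proof (rule Suc.IH)
    fix g assume g: "g \<in> irrelevant_power r"
    show "g * h \<in> Q"
    proof (rule Q)
      fix i
      show "pvar i * (g * h) \<in> Q"
        using Suc.prems[OF pvar_mult_mem_irrelevant_power[OF g, of i]] by (simp add: mult.assoc)
    qed
  qed
qed

lemma homog_sum: "(\<And>i. i \<in> A \<Longrightarrow> p i \<in> homog k) \<Longrightarrow> (\<Sum>i\<in>A. p i) \<in> homog k"
  by (induction A rule: infinite_finite_induct) (auto intro: homog_add)

text \<open>Integer degrees absorb the case \<open>d = 0\<close>: derivatives of a constant lie in
  \<open>homog (-1)\<close>, which is zero.\<close>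

lemma partial_deriv_homog:
  assumes "f \<in> homog d"
  shows "partial_deriv i f \<in> homog (d - 1)"
  unfolding partial_deriv_def
proof (rule homog_sum)
  fix m assume m: "m \<in> Poly_Mapping.keys f"
  show "Poly_Mapping.single (m - Poly_Mapping.single i 1)
       (of_nat (Poly_Mapping.lookup m i) * Poly_Mapping.lookup f m) \<in> homog (d - 1)"
  proof (cases "Poly_Mapping.lookup m i = 0")
    case False
    have "m - Poly_Mapping.single i 1 + Poly_Mapping.single i 1 = m"
      by (rule poly_mapping_eqI) (use False in \<open>auto simp: lookup_add lookup_minus lookup_single when_def\<close>)
    then have "mono_degree m = mono_degree (m - Poly_Mapping.single i 1) + 1"
      using mono_degree_add[of "m - Poly_Mapping.single i 1" "Poly_Mapping.single i 1"]
      by (simp only: mono_degree_single)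
    moreover have "int (mono_degree m) = d" using assms m by (simp add: homog_def)
    ultimately show ?thesis by (auto simp: homog_def split: if_splits)
  qed simp
qed

section \<open>Dimensions over the scalars of the quotient ring\<close>

lemma subfield_pconst: "subfield (range pconst) S3"
proof -
  interpret cring S3 by (rule S3_cring)
  have mult: "pconst a * pconst b = pconst (a * b)" for a b by (simp add: pconst_def mult_single)
  have inj: "pconst a = pconst b \<longleftrightarrow> a = b" for a b
    unfolding pconst_def by (metis lookup_single_eq)
  have one: "pconst 1 = 1" and zero: "pconst 0 = 0" by (simp_all add: pconst_def)
  have sub: "subring (range pconst) S3"
  proof (rule subringI)
    show "\<one>\<^bsub>S3\<^esub> \<in> range pconst" by (metis S3_simps(5) one rangeI)
    show "\<ominus>\<^bsub>S3\<^esub> h \<in> range pconst" if "h \<in> range pconst" for h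
      using that by (auto simp: S3_a_inv pconst_def single_uminus[symmetric])
  qed (auto simp: mult, auto simp: pconst_def single_add[symmetric])
  have "Units (S3 \<lparr>carrier := range pconst\<rparr>) = range pconst - {0}"
  proof (intro equalityI subsetI)
    fix x assume "x \<in> Units (S3 \<lparr>carrier := range pconst\<rparr>)"
    then obtain y where "x \<in> range pconst" "y * x = 1" by (auto simp: Units_def)
    then show "x \<in> range pconst - {0}" by auto
  next
    fix x assume "x \<in> range pconst - {0}"
    then obtain a where a: "x = pconst a" "a \<noteq> 0" using zero by auto
    then have "pconst (inverse a) * x = 1" "x * pconst (inverse a) = 1" by (simp_all add: mult one)
    then show "x \<in> Units (S3 \<lparr>carrier := range pconst\<rparr>)" using a by (auto simp: Units_def)
  qed
  then show ?thesis by (intro subfieldI subcringI'[OF sub]) simp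
qed

text \<open>Bridges the two notions of dimension, over a subfield of the quotient ring and over the
  complex numbers. A basis of the degree \<open>k\<close> part of \<open>J\<close> is extended to
  that of \<open>I\<close>; the classes of the added vectors form a basis of the quotient.\<close>

lemma dim_quotient_component:
  assumes J: "graded_ideal J" "J \<noteq> UNIV" and I: "graded_ideal I" "J \<subseteq> I"
  shows "real (ring.dim (S3 Quot J) ((\<lambda>c. J +>\<^bsub>S3\<^esub> pconst c) ` UNIV) ((\<lambda>h. J +>\<^bsub>S3\<^esub> h) ` (I \<inter> homog k)))
    = hdim I k - hdim J k"
proof -
  define Q where "Q = S3 Quot J"
  define \<pi> where "\<pi> = (\<lambda>h. J +>\<^bsub>S3\<^esub> h)"
  have idJ: "ideal J S3" by (rule ideal_if_graded_ideal[OF J(1)])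
  then interpret J: ideal J S3 .
  interpret h: ring_hom_ring S3 Q \<pi> unfolding Q_def \<pi>_def by (rule J.rcos_ring_hom_ring)
  have pi_eq: "\<pi> x = \<pi> y \<longleftrightarrow> x - y \<in> J" for x y
  proof
    assume eq: "\<pi> x = \<pi> y"
    have "0 \<in> J" using J(1) by (simp add: graded_ideal_def)
    then have "x \<in> \<pi> x" by (auto simp: \<pi>_def a_r_coset_def')
    then show "x - y \<in> J" unfolding eq by (auto simp: \<pi>_def a_r_coset_def')
  next
    assume xy: "x - y \<in> J"
    have "J +>\<^bsub>S3\<^esub> x \<subseteq> J +>\<^bsub>S3\<^esub> y" if "x - y \<in> J" for x y
    proof
      fix z assume "z \<in> J +>\<^bsub>S3\<^esub> x"
      then obtain j where j: "j \<in> J" "z = j + x" by (auto simp: a_r_coset_def')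
      then have "z = (j + (x - y)) + y" "j + (x - y) \<in> J" using J(1) that by (auto simp: graded_ideal_def)
      then show "z \<in> J +>\<^bsub>S3\<^esub> y" unfolding a_r_coset_def' by (intro UN_I[of "j + (x - y)"]) simp_all
    qed
    moreover have "y - x \<in> J" using graded_ideal_diff[OF J(1), of 0 "x - y"] xy J(1) by (simp add: graded_ideal_def)
    ultimately show "\<pi> x = \<pi> y" using xy unfolding \<pi>_def by blast
  qed
  have pi_add: "\<pi> (x + y) = \<pi> x \<oplus>\<^bsub>Q\<^esub> \<pi> y" and pi_mult: "\<pi> (x * y) = \<pi> x \<otimes>\<^bsub>Q\<^esub> \<pi> y" for x y
    using h.hom_add[of x y] h.hom_mult[of x y] by simp_all
  have pi_0: "\<pi> 0 = \<zero>\<^bsub>Q\<^esub>" using h.hom_zero by simp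
  define K where "K = \<pi> ` range pconst"
  \<comment> \<open>This is where properness of \<open>J\<close> enters: the image of the scalars is
    a field only if 1 and 0 stay distinct.\<close>
  have "\<pi> 1 \<noteq> \<pi> 0"
    unfolding pi_eq using J unfolding graded_ideal_def by (metis UNIV_I UNIV_eq_I diff_zero mult.right_neutral)
  then have K: "subfield K Q"
    unfolding K_def using h.hom_one pi_0 by (intro h.img_is_subfield(2)[OF subfield_pconst]) simp
  obtain F where F: "finite F" "homog k \<subseteq> poly3.span F" using homog_finite_span by blast
  have subI: "poly3.subspace (I \<inter> homog k)" and subJ: "poly3.subspace (J \<inter> homog k)"
    by (rule subspace_graded_ideal[OF I(1)], rule subspace_graded_ideal[OF J(1)])
  obtain B0 where B0: "B0 \<subseteq> J \<inter> homog k" "poly3.independent B0" "J \<inter> homog k \<subseteq> poly3.span B0"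
    "card B0 = poly3.dim (J \<inter> homog k)" by (rule poly3.basis_exists)
  have spanB0: "poly3.span B0 = J \<inter> homog k" by (intro equalityI poly3.span_minimal B0 subJ)
  have "B0 \<subseteq> I \<inter> homog k" using B0(1) I(2) by blast
  then obtain B where B: "B0 \<subseteq> B" "B \<subseteq> I \<inter> homog k" "poly3.independent B" "I \<inter> homog k \<subseteq> poly3.span B"
    using poly3.maximal_independent_subset_extend[of B0 "I \<inter> homog k"] B0(2) by blast
  have spanB: "poly3.span B = I \<inter> homog k" by (intro equalityI poly3.span_minimal B subI)
  have finB: "finite B" using poly3.independent_span_bound[OF F(1) B(3)] B(2) F(2) by blast
  have dimB: "card B = poly3.dim (I \<inter> homog k)" by (rule poly3.basis_card_eq_dim[OF B(2,4,3)])
  have step: "ring.dimension Q (card C) K (\<pi> ` poly3.span (B0 \<union> C))" if "finite C" "C \<subseteq> B - B0" for C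
    using that
  proof (induction C rule: finite_induct)
    case empty
    have "\<pi> x = \<zero>\<^bsub>Q\<^esub>" if "x \<in> J" for x using that pi_eq[of x 0] pi_0 by simp
    moreover have "0 \<in> J \<inter> homog k" using J(1) by (simp add: graded_ideal_def)
    ultimately have "\<pi> ` (J \<inter> homog k) = {\<zero>\<^bsub>Q\<^esub>}" by blast
    then show ?case using spanB0 h.S.dimension.zero_dim by simp
  next
    case (insert c C)
    have sub: "B0 \<union> C \<subseteq> B - {c}" and c: "c \<in> B" "c \<in> homog k" using insert B(1,2) by auto
    have notin: "\<pi> c \<notin> \<pi> ` poly3.span (B0 \<union> C)"
    proof
      assume "\<pi> c \<in> \<pi> ` poly3.span (B0 \<union> C)"
      then obtain w where w: "\<pi> c = \<pi> w" "w \<in> poly3.span (B0 \<union> C)" by blast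
      have "B0 \<union> C \<subseteq> B" using sub by blast
      then have "w \<in> homog k" using w(2) poly3.span_mono[of "B0 \<union> C" B] spanB by blast
      then have "c - w \<in> poly3.span B0" using w(1) c(2) by (simp add: pi_eq spanB0 homog_diff)
      then have "c - w \<in> poly3.span (B0 \<union> C)" using poly3.span_mono[of B0 "B0 \<union> C"] by blast
      then have "c - w + w \<in> poly3.span (B0 \<union> C)" using w(2) by (rule poly3.span_add)
      then have "c \<in> poly3.span (B - {c})" using poly3.span_mono[OF sub] by auto
      then show False using B(3) c(1) by (auto simp: poly3.dependent_def)
    qed
    have "h.S.line_extension K (\<pi> c) (\<pi> ` poly3.span (B0 \<union> C)) = \<pi> ` poly3.span (B0 \<union> insert c C)"
    proof (intro equalityI subsetI)
      fix x assume "x \<in> h.S.line_extension K (\<pi> c) (\<pi> ` poly3.span (B0 \<union> C))"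
      then obtain a w where aw: "x = \<pi> (pconst a) \<otimes>\<^bsub>Q\<^esub> \<pi> c \<oplus>\<^bsub>Q\<^esub> \<pi> w" "w \<in> poly3.span (B0 \<union> C)"
        unfolding h.S.line_extension_mem_iff K_def by blast
      have "x = \<pi> (pconst a * c + w)" using aw(1) by (simp only: pi_add pi_mult)
      moreover have "pconst a * c + w \<in> poly3.span (insert c (B0 \<union> C))"
        unfolding poly3.span_breakdown_eq using aw(2) by (intro exI[of _ a]) simp
      ultimately show "x \<in> \<pi> ` poly3.span (B0 \<union> insert c C)" by simp
    next
      fix x assume "x \<in> \<pi> ` poly3.span (B0 \<union> insert c C)"
      then obtain w where w: "x = \<pi> w" "w \<in> poly3.span (insert c (B0 \<union> C))" by auto
      then obtain a where a: "w - pconst a * c \<in> poly3.span (B0 \<union> C)" unfolding poly3.span_breakdown_eq by blast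
      have "w = pconst a * c + (w - pconst a * c)" by simp
      then have "x = \<pi> (pconst a) \<otimes>\<^bsub>Q\<^esub> \<pi> c \<oplus>\<^bsub>Q\<^esub> \<pi> (w - pconst a * c)"
        unfolding w(1) by (metis pi_add pi_mult)
      then show "x \<in> h.S.line_extension K (\<pi> c) (\<pi> ` poly3.span (B0 \<union> C))"
        unfolding h.S.line_extension_mem_iff K_def using a by blast
    qed
    moreover have "h.S.dimension (Suc (card C)) K (h.S.line_extension K (\<pi> c) (\<pi> ` poly3.span (B0 \<union> C)))"
      using notin insert by (intro h.S.dimension.Suc_dim) (use h.hom_closed[of c] in simp_all)
    ultimately show ?case using insert.hyps by simp
  qed
  have "B0 \<union> (B - B0) = B" using B(1) by blast
  then have "h.S.dimension (card (B - B0)) K (\<pi> ` (I \<inter> homog k))"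
    using step[of "B - B0"] finB spanB by simp
  then have "h.S.dim K (\<pi> ` (I \<inter> homog k)) = card (B - B0)"
    using h.S.dimI[OF K] by (simp add: over_def)
  moreover have "card (B - B0) + card B0 = card B"
    using B(1) finB by (metis card_Diff_subset card_mono finite_subset le_add_diff_inverse2)
  ultimately have "real (h.S.dim K (\<pi> ` (I \<inter> homog k))) = hdim I k - hdim J k"
    unfolding hdim_def dimB[symmetric] B0(4)[symmetric] by linarith
  then show ?thesis unfolding Q_def K_def \<pi>_def image_image by simp
qed

section \<open>The Hilbert function of the saturation modulo the Jacobian ideal\<close>

lemma homog_0_dvd_1:
  assumes "p \<in> homog 0" "p \<noteq> 0"
  shows "p dvd 1"
proof -
  note p = homog_0_eq_pconst[OF assms(1)]
  have "Poly_Mapping.lookup p 0 \<noteq> 0" using assms(2) p by (auto simp: pconst_def)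
  then have "p * pconst (inverse (Poly_Mapping.lookup p 0)) = 1"
    by (subst p) (simp add: pconst_def mult_single)
  then show ?thesis by (metis dvd_triv_left)
qed

text \<open>Both colon ideals are known: \<open>0 : f\<close> is 0 and \<open>(f) : g\<close> is
  \<open>(f)\<close>.\<close>

lemma hdim_regular_pair:
  assumes reg: "regular_pair f g" and f: "f \<in> homog i" and g: "g \<in> homog j"
  shows "hdim (adjoin (adjoin {0} f) g) k = hilb3 (k - i) + hilb3 (k - j) - hilb3 (k - i - j)"
proof -
  have "colon {0} f = {0}" using reg by (auto simp: colon_def regular_pair_def)
  then have f1: "hdim (adjoin {0} f) k = hilb3 (k - i)" for k
    using hdim_adjoin[OF graded_ideal_zero f, of k] by (simp add: hdim_zero hdim_UNIV)
  have "f dvd h * g \<longleftrightarrow> f dvd h" for h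
    using reg dvd_mult2[of f h g] unfolding regular_pair_def by blast
  then have "h \<in> colon (adjoin {0} f) g \<longleftrightarrow> h \<in> adjoin {0} f" for h
    unfolding colon_def mem_Collect_eq mem_adjoin_zero_dvd by simp
  then have "colon (adjoin {0} f) g = adjoin {0} f" by blast
  then show ?thesis
    using hdim_adjoin[OF graded_ideal_adjoin[OF graded_ideal_zero f] g, of k]
    by (simp add: f1 hdim_UNIV algebra_simps)
qed

lemma homog_combination:
  assumes "f \<in> adjoin (adjoin {0} g1) g2" "f \<in> homog e" "g1 \<in> homog a" "g2 \<in> homog b"
  obtains u v where "f = u * g1 + v * g2" "u \<in> homog (e - a)" "v \<in> homog (e - b)"
proof -
  obtain p q where "f = p * g1 + q * g2" using assms(1) by (auto simp: mem_adjoin2)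
  then have "hpart e f = hpart (e - a) p * g1 + hpart (e - b) q * g2"
    using hpart_mult[OF assms(3)] hpart_mult[OF assms(4)] by (simp add: hpart_add)
  then have "f = hpart (e - a) p * g1 + hpart (e - b) q * g2" using hpart_self[OF assms(2)] by simp
  then show thesis by (rule that[OF _ hpart_homog hpart_homog])
qed

text \<open>A divisor of all of \<open>J\<close> divides the whole saturation, because the regular
  pair of two variables lets it pass from \<open>x * q\<close> and \<open>y * q\<close> to
  \<open>q\<close>. So it divides \<open>g1\<close> and \<open>g2\<close>, and a common factor of a
  regular pair is a unit.\<close>

lemma dvd_1_if_dvd_saturated_regular_pair:
  assumes sat: "g1 \<in> saturation J" "g2 \<in> saturation J" and reg: "regular_pair g1 g2"
    and p: "\<And>h. h \<in> J \<Longrightarrow> p dvd h"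
  shows "p dvd 1"
proof -
  have pg: "p dvd h" if h: "h \<in> saturation J" for h
  proof -
    obtain r where r: "\<forall>g\<in>irrelevant_power r. g * h \<in> J" using h unfolding saturation_def by blast
    have "h \<in> {q. p dvd q}"
    proof (rule mem_if_irrelevant_power_mult_mem)
      fix q assume q: "\<And>i. pvar i * q \<in> {q. p dvd q}"
      show "q \<in> {q. p dvd q}"
      proof (cases "p = 0")
        case True
        have "pvar 1 \<noteq> 0" using regular_pair_pvar[of 1 2] by (simp add: regular_pair_def)
        then show ?thesis using q[of 1] True by simp
      next
        case False
        then show ?thesis
          using dvd_if_dvd_mult_regular_pair[OF regular_pair_pvar[of 1 2], of p q] q[of 1] q[of 2] by simp
      qed
    qed (use r p in blast)
    then show ?thesis by simp
  qed
  obtain s t where st: "g1 = p * s" "g2 = p * t" using pg sat by (meson dvdE)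
  \<comment> \<open>Regularity makes \<open>g1 = p * s\<close> a divisor of \<open>s\<close>;
    cancelling \<open>s\<close> leaves \<open>p\<close> a unit.\<close>
  have "s * g2 = g1 * t" unfolding st by (simp add: mult_ac)
  then have "g1 dvd s * g2" by simp
  then have "g1 dvd s" using reg unfolding regular_pair_def by blast
  then obtain u where u: "s = g1 * u" by (rule dvdE)
  have "s * (p * u) = g1 * u" unfolding st(1) by (simp add: mult_ac)
  then have "s * 1 = s * (p * u)" by (simp only: u[symmetric] mult_1_right)
  moreover have "s \<noteq> 0" using reg unfolding regular_pair_def st(1) by auto
  ultimately have "1 = p * u" by simp
  then show ?thesis by (rule dvdI)
qed

text \<open>The forms \<open>f1, f2, f3\<close> stand for generators of \<open>J\<close> after a
  linear change that makes the first two a regular pair, not for the partial derivatives in their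
  given order.\<close>

locale jacobian_like =
  fixes J I :: "poly3 set" and g1 g2 f1 f2 f3 :: poly3 and a b e :: int
  assumes g: "g1 \<in> homog a" "g2 \<in> homog b" "regular_pair g1 g2"
    and I: "I = adjoin (adjoin {0} g1) g2" "I \<noteq> UNIV" "I \<subseteq> saturation J"
    and f: "f1 \<in> homog e" "f2 \<in> homog e" "f3 \<in> homog e" "regular_pair f1 f2"
    and J: "J = adjoin (adjoin (adjoin {0} f1) f2) f3" "J \<subseteq> I"
begin

definition "CI = adjoin (adjoin {0} f1) f2"

lemma graded: "graded_ideal CI" "graded_ideal J" "graded_ideal I"
  unfolding CI_def J(1) I(1)
  by (intro graded_ideal_adjoin[OF _ g(1)] graded_ideal_adjoin[OF _ g(2)] graded_ideal_adjoin[OF _ f(1)]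
      graded_ideal_adjoin[OF _ f(2)] graded_ideal_adjoin[OF _ f(3)] graded_ideal_zero)+

lemma f_mem_J: "f1 \<in> J" "f2 \<in> J" "f3 \<in> J"
proof -
  have "f1 = 1 * f1 + 0 * f2 + 0 * f3" "f2 = 0 * f1 + 1 * f2 + 0 * f3" "f3 = 0 * f1 + 0 * f2 + 1 * f3" by simp_all
  then show "f1 \<in> J" "f2 \<in> J" "f3 \<in> J" unfolding J(1) mem_adjoin3 by blast+
qed

lemma g_mem_I: "g1 \<in> I" "g2 \<in> I"
proof -
  have "g1 = 1 * g1 + 0 * g2" "g2 = 0 * g1 + 1 * g2" by simp_all
  then show "g1 \<in> I" "g2 \<in> I" unfolding I(1) mem_adjoin2 by blast+
qed

text \<open>A nonzero form of degree at most 0 is a unit, which the proper ideal \<open>I\<close>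
  excludes; and \<open>g2 = 0\<close> would make \<open>g1\<close> a unit.\<close>

lemma degrees_pos: "1 \<le> a" "1 \<le> b"
proof -
  have no_unit: "\<not> h dvd 1" if "h \<in> I" for h
  proof
    assume "h dvd 1"
    then obtain c where "c * h = 1" by (metis dvdE mult.commute)
    then have "x = (x * c) * h" for x by (simp add: mult.assoc)
    then have "x \<in> I" for x using graded(3) that unfolding graded_ideal_def by metis
    then show False using I(2) by blast
  qed
  have pos: "1 \<le> c" if "h \<in> homog c" "h \<noteq> 0" "h \<in> I" for h c
  proof (rule ccontr)
    assume "\<not> 1 \<le> c"
    then have "c < 0 \<or> c = 0" by linarith
    then show False using that no_unit[of h] homog_neg[of c] homog_0_dvd_1[of h] by auto
  qed
  have "g1 \<noteq> 0" using g(3) by (simp add: regular_pair_def)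
  then show "1 \<le> a" using pos g(1) g_mem_I(1) by blast
  have "g2 \<noteq> 0"
  proof
    assume "g2 = 0"
    then have "g1 dvd 1 * g2" by simp
    then have "g1 dvd 1" using g(3) unfolding regular_pair_def by blast
    then show False using no_unit g_mem_I(1) by blast
  qed
  then show "1 \<le> b" using pos g(2) g_mem_I(2) by blast
qed

text \<open>The quotient by \<open>CI\<close> has positive depth, so \<open>CI\<close> is its own
  saturation.\<close>

lemma mem_CI_if_pvar_mult_mem:
  assumes "\<And>i. pvar i * q \<in> CI"
  shows "q \<in> CI"
proof -
  have "colon (adjoin (adjoin {0} (pvar 1)) (pvar 2)) (pvar 3) \<subseteq> adjoin (adjoin {0} (pvar 1)) (pvar 2)"
    unfolding adjoin_pvar2 by (simp add: colon_monomial_ideal_pvar)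
  then show ?thesis
    using mem_adjoin2_if_mult_mem[OF regular_pair_pvar[of 1 2] _ f(4)] assms unfolding CI_def by simp
qed

text \<open>If \<open>h\<close> carries \<open>f3\<close> into \<open>CI\<close>, it carries all of
  \<open>J\<close> there. Some power of the irrelevant ideal sends \<open>x\<close> into
  \<open>J\<close>, and since \<open>CI\<close> is saturated that power can be removed.\<close>

lemma mult_mem_CI:
  assumes h: "h * f3 \<in> CI" and x: "x \<in> I"
  shows "h * x \<in> CI"
proof -
  have hJ: "h * y \<in> CI" if y: "y \<in> J" for y
  proof -
    obtain c1 c2 c3 where "y = c1 * f1 + c2 * f2 + c3 * f3" using y unfolding J(1) mem_adjoin3 by blast
    then have "h * y = ((h * c1) * f1 + (h * c2) * f2) + c3 * (h * f3)" by (simp add: algebra_simps)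
    moreover have "(h * c1) * f1 + (h * c2) * f2 \<in> CI" unfolding CI_def mem_adjoin2 by blast
    ultimately show ?thesis using h graded(1) by (simp add: graded_ideal_def)
  qed
  obtain r where r: "\<forall>g\<in>irrelevant_power r. g * x \<in> J" using x I(3) unfolding saturation_def by blast
  show ?thesis
  proof (rule mem_if_irrelevant_power_mult_mem[OF mem_CI_if_pvar_mult_mem])
    fix g assume "g \<in> irrelevant_power r"
    then have "h * (g * x) \<in> CI" using hJ r by blast
    then show "g * (h * x) \<in> CI" by (simp add: mult.left_commute)
  qed
qed

text \<open>\<open>J\<close> arises from \<open>CI\<close> by adjoining \<open>f3\<close>, with
  colon ideal \<open>CI + (D)\<close>; the latter arises by adjoining \<open>D\<close>, with colon
  ideal \<open>I\<close>. Two uses of \<open>hdim_adjoin\<close> thus express everything through two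
  regular pairs.\<close>

lemma hdim_formula:
  shows "hdim I k - hdim J k = hilbN a b e k" and "a \<le> e" and "b \<le> e"
proof -
  obtain u1 v1 where 1: "f1 = u1 * g1 + v1 * g2" "u1 \<in> homog (e - a)" "v1 \<in> homog (e - b)"
    using homog_combination[OF _ f(1) g(1,2)] f_mem_J(1) J(2) I(1) by blast
  obtain u2 v2 where 2: "f2 = u2 * g1 + v2 * g2" "u2 \<in> homog (e - a)" "v2 \<in> homog (e - b)"
    using homog_combination[OF _ f(2) g(1,2)] f_mem_J(2) J(2) I(1) by blast
  define D where "D = u1 * v2 - u2 * v1"
  have D: "D \<in> homog (2 * e - a - b)"
    using homog_diff[OF homog_mult[OF 1(2) 2(3)] homog_mult[OF 2(2) 1(3)]] by (simp add: D_def algebra_simps)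
  have colD: "colon CI D = I"
    unfolding CI_def D_def I(1) by (rule colon_linked_determinant[OF 1(1) 2(1) f(4)])
  have "D \<noteq> 0"
  proof
    assume "D = 0"
    then have "colon CI D = UNIV" using graded(1) by (auto simp: colon_def graded_ideal_def)
    then show False using colD I(2) by simp
  qed
  \<comment> \<open>If \<open>a > e\<close>, then \<open>u1\<close> and \<open>u2\<close> have
    negative degree, so a column of the matrix vanishes and with it \<open>D\<close>; likewise for
    \<open>b\<close>.\<close>
  then have "\<not> (u1 = 0 \<and> u2 = 0)" "\<not> (v1 = 0 \<and> v2 = 0)" by (auto simp: D_def)
  then show "a \<le> e" "b \<le> e"
    using 1(2,3) 2(2,3) homog_neg[of "e - a"] homog_neg[of "e - b"] by force+
  have colf3: "colon CI f3 = adjoin CI D"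
  proof (intro equalityI subsetI)
    fix h assume "h \<in> colon CI f3"
    then have "h * f3 \<in> CI" by (simp add: colon_def)
    from mult_mem_CI[OF this g_mem_I(1)] mult_mem_CI[OF this g_mem_I(2)] show "h \<in> adjoin CI D"
      unfolding CI_def D_def by (rule linked_colon_subset[OF 1(1) 2(1) f(4) g(3)])
  next
    fix h assume "h \<in> adjoin CI D"
    then obtain x c where h: "h = x + c * D" "x \<in> CI" by (auto simp: adjoin_def)
    \<comment> \<open>Membership of \<open>f3\<close> in \<open>CI : D\<close> is the same as
      membership of \<open>D\<close> in \<open>CI : f3\<close>.\<close>
    have "f3 \<in> colon CI D" unfolding colD using f_mem_J(3) J(2) by blast
    then have "f3 * D \<in> CI" by (simp add: colon_def)
    moreover have "h * f3 = f3 * x + c * (f3 * D)" using h(1) by (simp add: algebra_simps)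
    ultimately show "h \<in> colon CI f3"
      using h(2) graded(1) by (simp add: colon_def graded_ideal_def)
  qed
  have CI: "hdim CI k = 2 * hilb3 (k - e) - hilb3 (k - 2 * e)" for k
    using hdim_regular_pair[OF f(4) f(1) f(2), of k] by (simp add: CI_def diff_diff_eq)
  have hI: "hdim I k = hilb3 (k - a) + hilb3 (k - b) - hilb3 (k - a - b)" for k
    unfolding I(1) by (rule hdim_regular_pair[OF g(3) g(1) g(2)])
  have CID: "hdim (adjoin CI D) k = hdim CI k + hilb3 (k - (2 * e - a - b)) - hdim I (k - (2 * e - a - b))" for k
    using hdim_adjoin[OF graded(1) D, of k] by (simp add: colD hdim_UNIV)
  have hJ: "hdim J k = hdim CI k + hilb3 (k - e) - hdim (adjoin CI D) (k - e)"
    using hdim_adjoin[OF graded(1) f(3), of k] unfolding J(1) CI_def[symmetric] by (simp add: colf3 hdim_UNIV)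
  have eqs: "k - e - (2 * e - a - b) = k - 3 * e + a + b" "k - 3 * e + a + b - a = k - 3 * e + b"
    "k - 3 * e + a + b - b = k - 3 * e + a" "k - 3 * e + a + b - a - b = k - 3 * e"
    "k - e - e = k - 2 * e" "k - e - 2 * e = k - 3 * e" by simp_all
  \<comment> \<open>The two terms \<open>hilb3 (k - 3 * e)\<close>, one from \<open>CI\<close> and
    one from the shifted \<open>I\<close>, cancel.\<close>
  show "hdim I k - hdim J k = hilbN a b e k"
    unfolding hJ CID unfolding hI CI unfolding eqs hilbN_def by simp
qed

end

section \<open>Passage from the given definitions to the linkage setting\<close>

lemma regular_pair_if_regular_sequence:
  assumes reg: "regular_sequence [g1, g2]" and g1: "g1 \<in> homog a"
  shows "regular_pair g1 g2"
proof -
  have 1: "h \<in> Idl\<^bsub>S3\<^esub> (set (take i [g1, g2]))" if "i < 2" "[g1, g2] ! i * h \<in> Idl\<^bsub>S3\<^esub> (set (take i [g1, g2]))" for i h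
    using reg that unfolding regular_sequence_def by auto
  \<comment> \<open>With index 0 and \<open>h = 1\<close>: \<open>g1 = 0\<close> would put 1 into
    the zero ideal.\<close>
  have "g1 \<noteq> 0" using 1[of 0 1] by (auto simp: Idl_empty)
  moreover have "Idl\<^bsub>S3\<^esub> {g1} = adjoin {0} g1"
    using Idl_insert(1)[OF Idl_empty graded_ideal_zero g1] by simp
  then have "h \<in> adjoin {0} g1" if "g2 * h \<in> adjoin {0} g1" for h
    using 1[of 1 h] that by simp
  ultimately show ?thesis unfolding regular_pair_def mem_adjoin_zero_dvd by (metis mult.commute)
qed

lemma Idl_pair:
  assumes "g1 \<in> homog a" "g2 \<in> homog b"
  shows "Idl\<^bsub>S3\<^esub> {g1, g2} = adjoin (adjoin {0} g1) g2"
  using Idl_insert(1)[OF Idl_insert[OF Idl_empty graded_ideal_zero assms(1)] assms(2)]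
  by (simp add: insert_commute)

lemma Idl_triple:
  assumes "g1 \<in> homog a" "g2 \<in> homog b" "g3 \<in> homog c"
  shows "Idl\<^bsub>S3\<^esub> {g1, g2, g3} = adjoin (adjoin (adjoin {0} g1) g2) g3"
  using Idl_insert(1)[OF Idl_insert[OF Idl_insert[OF Idl_empty graded_ideal_zero assms(1)] assms(2)] assms(3)]
  by (simp add: insert_commute)

lemma subset_saturation: "ideal J S3 \<Longrightarrow> J \<subseteq> saturation J"
  unfolding saturation_def ideal_S3_iff by blast

theorem theorem1p2:
  fixes f :: poly3 and d :: nat
  assumes "homogeneous d f"
    and "only_isolated_singularities f"
    and "complete_intersection_ideal (saturated_jacobian_ideal f)"
  shows "\<exists>P :: real poly. HP_N f = fps_of_poly P \<and> log_concave_poly P \<and>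
           no_internal_zeros_poly P \<and> unimodal_poly P"
proof -
  define F where "F i = partial_deriv i f" for i
  define e where "e = int d - 1"
  define J where "J = jacobian_ideal f"
  define I where "I = saturated_jacobian_ideal f"
  have F: "F i \<in> homog e" for i
    unfolding F_def e_def by (rule partial_deriv_homog) (use assms(1) in \<open>simp add: homogeneous_iff_homog\<close>)
  have J_eq: "J = adjoin (adjoin (adjoin {0} (F i)) (F j)) (F l)" if "(UNIV :: 3 set) = {i, j, l}" for i j l
  proof -
    have "range (\<lambda>i. partial_deriv i f) = {F i, F j, F l}" unfolding that F_def by auto
    then show ?thesis unfolding J_def jacobian_ideal_def by (simp add: Idl_triple[OF F F F])
  qed
  have I_sat: "I = saturation J" by (simp add: I_def J_def saturated_jacobian_ideal_def)
  have JI: "J \<subseteq> I"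
    unfolding I_sat J_def jacobian_ideal_def
    by (intro subset_saturation ring.genideal_ideal[OF S3_ring]) simp
  obtain g1 g2 d1 d2 where ci: "homogeneous d1 g1" "homogeneous d2 g2" "regular_sequence [g1, g2]" "I = Idl\<^bsub>S3\<^esub> {g1, g2}"
    using assms(3) unfolding complete_intersection_ideal_def I_def by blast
  have g: "g1 \<in> homog (int d1)" "g2 \<in> homog (int d2)" using ci(1,2) by (simp_all add: homogeneous_iff_homog)
  have reg: "regular_pair g1 g2" by (rule regular_pair_if_regular_sequence[OF ci(3) g(1)])
  have I_eq: "I = adjoin (adjoin {0} g1) g2" unfolding ci(4) by (rule Idl_pair[OF g])
  have I_proper: "I \<noteq> UNIV" using ci(3,4) by (simp add: regular_sequence_def)
  have "g1 = 1 * g1 + 0 * g2" "g2 = 0 * g1 + 1 * g2" by simp_all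
  then have gI: "g1 \<in> saturation J" "g2 \<in> saturation J"
    unfolding I_sat[symmetric] I_eq mem_adjoin2 by blast+
  \<comment> \<open>Used twice: for \<open>p = 0\<close> it shows that some partial derivative is
    nonzero, and for general \<open>p\<close> it provides the regular pair.\<close>
  have avoid: "p dvd 1" if "\<And>i. p dvd F i" for p
  proof (rule dvd_1_if_dvd_saturated_regular_pair[OF gI reg])
    fix h assume "h \<in> J"
    then obtain c1 c2 c3 where "h = c1 * F 1 + c2 * F 2 + c3 * F 3"
      unfolding J_eq[OF UNIV_3] mem_adjoin3 by blast
    then show "p dvd h" using that by simp
  qed
  have "\<exists>i. F i \<noteq> 0"
  proof (rule ccontr)
    assume "\<not> ?thesis"
    then have "(0 :: poly3) dvd 1" using avoid[of 0] by simp
    then show False by simp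
  qed
  then obtain i where i: "F i \<noteq> 0" by blast
  obtain j l where ijl: "(UNIV :: 3 set) = {i, j, l}"
    using exhaust_3[of i] UNIV_3 by (metis insert_commute)
  have "\<exists>c. regular_pair (F i) (F j + pconst c * F l)"
  proof (rule exists_regular_pair[OF i])
    fix p assume "p dvd F i" "p dvd F j" "p dvd F l"
    then have "p dvd F n" for n using ijl by (metis UNIV_I insertE singletonD)
    then show "p dvd 1" by (rule avoid)
  qed
  then obtain c where c: "regular_pair (F i) (F j + pconst c * F l)" by blast
  \<comment> \<open>The change of generators is triangular: \<open>F l\<close> is kept, so
    \<open>F j\<close> can be recovered.\<close>
  have J_eq': "J = adjoin (adjoin (adjoin {0} (F i)) (F j + pconst c * F l)) (F l)"
  proof (intro equalityI subsetI)
    fix h assume "h \<in> J"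
    then obtain x y z where "h = x * F i + y * F j + z * F l" unfolding J_eq[OF ijl] mem_adjoin3 by blast
    then have "h = x * F i + y * (F j + pconst c * F l) + (z - y * pconst c) * F l" by (simp add: algebra_simps)
    then show "h \<in> adjoin (adjoin (adjoin {0} (F i)) (F j + pconst c * F l)) (F l)" unfolding mem_adjoin3 by blast
  next
    fix h assume "h \<in> adjoin (adjoin (adjoin {0} (F i)) (F j + pconst c * F l)) (F l)"
    then obtain x y z where "h = x * F i + y * (F j + pconst c * F l) + z * F l" unfolding mem_adjoin3 by blast
    then have "h = x * F i + y * F j + (z + y * pconst c) * F l" by (simp add: algebra_simps)
    then show "h \<in> J" unfolding J_eq[OF ijl] mem_adjoin3 by blast
  qed
  interpret jacobian_like J I g1 g2 "F i" "F j + pconst c * F l" "F l" "int d1" "int d2" e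
    by unfold_locales
      (use g reg I_eq I_proper I_sat F c J_eq' JI in \<open>simp_all add: homog_add homog_pconst_mult\<close>)
  have J_proper: "J \<noteq> UNIV" using JI I_proper by blast
  note dim = dim_quotient_component[OF graded(2) J_proper graded(3) JI, unfolded hdim_formula(1)]
  have "N_component f k = (\<lambda>h. J +>\<^bsub>S3\<^esub> h) ` (I \<inter> homog (int k))" for k
    unfolding N_component_def J_def I_def homogeneous_iff_homog by (rule arg_cong[of _ _ "image _"]) auto
  then have "HP_N f = Abs_fps (\<lambda>k. hilbN (int d1) (int d2) e (int k))"
    unfolding HP_N_def milnor_algebra_def milnor_scalars_def J_def[symmetric] by (simp only: dim)
  \<comment> \<open>The nonnegativity assumed throughout the numerical part holds because the value
    is a dimension.\<close>
  moreover have "hilbN (int d1) (int d2) e k \<ge> 0" for k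
    unfolding dim[symmetric] by simp
  ultimately show ?thesis
    using hilbN_polynomial[OF degrees_pos hdim_formula(2,3)] by simp
qed

end
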